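(* Let $(M,\omega)$ be a symplectic manifold and let $G$ be a Lie group acting symplectically on $M$ with momentum map $J:M\to\mathfrak g^*$ (relative to a non-degenerate pairing $\kappa:\mathfrak g^*\times\mathfrak g\to\mathbb R$). Let $(P,\theta)$ be a Cartan geometry $\pi:P\to B$ over a simply connected manifold $B$, modeled on a Klein pair $(\mathfrak a,\mathfrak g)$ with group $G$, which is an orbit through $m\in M$ via $\chi:P\to M$, and let $\kappa_{\mathfrak a}$ be a duality of $(\mathfrak a,\mathfrak g)$. Assume that $J$ is $\mathfrak a$-equivariant and $\theta$ is torsion-free, and let $\Psi_m:B\to\mathbb R$ be the Kempf--Ness function. Then: (i) A point $b\in B$ is a critical point of $\Psi_m$ if and only if for some (and hence for all) $p\in\pi^{-1}(b)$ one has $\kappa_{\mathfrak a}(J(\chi(p)),\xi)=0$ for all $\xi\in\mathfrak a$. (ii) For $\xi\in\mathfrak a$, let $\gamma_\xi:[0,\delta]\to P$ be an integral curve of the vector field $\theta^{-1}(\xi)$ and put $p=\gamma_\xi(0)$. If $\pi(p)$ is a critical point of $\Psi_m$, then $$\frac{d^2}{dt^2}\Big|_{t=0}\Psi_m\big(\pi(\gamma_\xi(t))\big)=\kappa_{\mathfrak a}(C_p\xi,\xi).$$ (iii) Assume in addition that $M$ carries an almost complex structure $j$ compatible with $\omega$, that $\mathfrak a=\mathfrak g\oplus i\,\mathfrak m\subseteq\mathfrak g_{\mathbb C}$ for a subspace $\mathfrak m\subseteq\mathfrak g$ with $[\mathfrak g,i\mathfrak m]\subseteq i\mathfrak m$,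 that $\kappa_{\mathfrak a}(\mu,\xi_1+i\xi_2)=-\kappa(\mu,\xi_2)$ for $\mu\in\mathfrak g^*$, $\xi_1\in\mathfrak g$, $\xi_2\in\mathfrak m$, and that the infinitesimal action is complex linear: $\rho(\xi_1+i\xi_2,p)=\rho(\xi_1,p)+j\rho(\xi_2,p)$ for all $p\in P$, $\xi_1\in\mathfrak g$, $\xi_2\in\mathfrak m$. Then, for $\xi\in\mathfrak a$ and an integral curve $\gamma_\xi$ of $\theta^{-1}(\xi)$ such that $\pi(p)$, $p=\gamma_\xi(0)$, is a critical point of $\Psi_m$, $$\frac{d^2}{dt^2}\Big|_{t=0}\Psi_m\big(\pi(\gamma_\xi(t))\big)=-\kappa\big(C_p(i\,\mathrm{Im}\,\xi),\mathrm{Im}\,\xi\big)=\big\|(\mathrm{Im}\,\xi)\cdot\chi(p)\big\|^2,$$ where the norm is taken with respect to the Riemannian metric $\omega(\cdot,j\,\cdot)$. Moreover, if $\xi\in i\mathfrak m$, then $\Psi_m$ is convex along $\pi\circ\gamma_\xi$: for all $t$, $$\frac{d^2}{dt^2}\Psi_m\big(\pi(\gamma_\xi(t))\big)=\big\|\xi\cdot\chi(\gamma_\xi(t))\big\|^2 .$$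
   Context: Manifolds and Lie groups are smooth and possibly infinite-dimensional (modeled on locally convex spaces); linear and bilinear maps between topological vector spaces are understood to be continuous. A Klein pair $(\mathfrak a,\mathfrak g)$ with group $G$ consists of a Lie algebra $\mathfrak a$, a Lie subalgebra $\mathfrak g\subseteq\mathfrak a$ which is closed and has a closed topological complement, a Lie group $G$ with Lie algebra $\mathfrak g$, and a representation $\mathrm{Ad}$ of $G$ on $\mathfrak a$ restricting to the adjoint representation on $\mathfrak g$. ($\mathfrak a$ need not integrate to a Lie group.) For $\mathfrak a=\mathfrak g\oplus i\mathfrak m\subseteq\mathfrak g_{\mathbb C}$ the bracket and $\mathrm{Ad}$ are restrictions of the complex (bi)linear extensions, and $\mathrm{Im}(\xi_1+i\xi_2)=\xi_2$. A Cartan geometry $(P,\theta)$ modeled on $(\mathfrak a,\mathfrak g)$ with group $G$ on a manifold $B$ is a left principal $G$-bundle $\pi:P\to B$ with a $1$-form $\theta\in\Omega^1(P,\mathfrak a)$ such that $\theta_p:T_pP\to\mathfrak a$ is an isomorphism for all $p$, $\theta_{g\cdot p}(g\cdot X)=\mathrm{Ad}_g\theta_p(X)$ for all $g \in G$, $X\in T_pP$, and $\theta(\xi^* )=\xi$ for $\xi\in\mathfrak g$, where $\xi^*$ is the fundamental vector field. For $\xi\in\mathfrak a$, $\theta^{-1}(\xi)$ denotes the (smooth) vector field $p\mapsto\theta_p^{-1}(\xi)$. The curvature is $\Omega:=d\theta-\frac12[\theta\wedge\theta]$, where $\frac12[\theta\wedge\theta](X,Y)=[\theta(X),\theta(Y)]$;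 $\theta$ is torsion-free if $\Omega$ takes values in $\mathfrak g$. $(P,\theta)$ is an orbit through $m\in M$ (where $G$ acts on $M$) if (a) there is a smooth $G$-equivariant map $\chi:P\to M$ whose image contains $m$; (b) there is a Lie subalgebra $\mathfrak a_m\subseteq\mathfrak a$ and a right Lie algebra action of $\mathfrak a_m$ on $P$, $\zeta\mapsto\zeta^*$, commuting with the $G$-action and satisfying $T\chi(\zeta^* )=0$. The infinitesimal action is $\rho(\xi,p)=\rho_p(\xi):=T_p\chi(\theta_p^{-1}(\xi))\in T_{\chi(p)}M$ for $\xi\in\mathfrak a$, also written $\xi\cdot\chi(p)$. A momentum map relative to $\kappa$ is a smooth map $J:M\to\mathfrak g^*$ with $\omega_m(\xi\cdot m,X)+\kappa(T_mJ(X),\xi)=0$ for all $m\in M$, $X\in T_mM$, $\xi\in\mathfrak g$; here $\mathfrak g^*$ is a chosen vector space non-degenerately paired with $\mathfrak g$ by $\kappa$ (not necessarily the topological dual), and the coadjoint action on $\mathfrak g^*$ is dual to $\mathrm{Ad}$ via $\kappa$. Its non-equivariance $1$-cocycle $\sigma:G\to\mathfrak g^*$ is given by $J(g\cdot m)=\mathrm{Ad}^*_{g^{-1}}J(m)+\sigma(g)$ (independent of $m$). A duality of $(\mathfrak a,\mathfrak g)$ is an $\mathrm{Ad}_G$-invariant bilinear map $\kappa_{\mathfrak a}:\mathfrak g^*\times\mathfrak a\to\mathbb R$ vanishing on $\mathfrak g^*\times\mathfrak g$. The Calabi operator is $C_p:=T_{\chi(p)}J\circ\rho_p:\mathfrak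 a\to\mathfrak g^*$. $J$ is $\mathfrak a$-equivariant relative to $\kappa_{\mathfrak a}$ if $\kappa_{\mathfrak a}(C_p\xi,\eta)-\kappa_{\mathfrak a}(C_p\eta,\xi)=-\kappa_{\mathfrak a}(J(\chi(p)),[\xi,\eta])$ for all $p\in P$, $\xi,\eta\in\mathfrak a$, and $\kappa_{\mathfrak a}(\sigma(g),\xi)=0$ for all $g\in G$, $\xi\in\mathfrak a$. Kempf--Ness function: under the hypotheses ($J$ $\mathfrak a$-equivariant, $\theta$ torsion-free, $B$ simply connected), the $1$-form $\alpha_p(X)=\kappa_{\mathfrak a}(J(\chi(p)),\theta_p(X))$ on $P$ descends to a closed $1$-form $\check\alpha$ on $B$ and there is a function $\Psi_m:B\to\mathbb R$, unique up to a constant, with $d\Psi_m=\check\alpha$; it is called the Kempf--Ness function at $m$. Compatibility of $j$ with $\omega$ means that $\omega(\cdot,j\,\cdot)$ is a Riemannian metric on $M$. *)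

theory Defs
  imports "HOL-Analysis.Analysis" "HOL-Algebra.Group"
begin

section \<open>Calculus on locally convex spaces\<close>

class locally_convex = real_vector + topological_ab_group_add + t2_space +
  assumes tendsto_scaleR_Pair: "LIM x (nhds r \<times>\<^sub>F nhds a). fst x *\<^sub>R snd x :> nhds (r *\<^sub>R a)"
    and convex_neighbourhoods: "open U \<Longrightarrow> 0 \<in> U \<Longrightarrow> \<exists>V. open V \<and> 0 \<in> V \<and> V \<subseteq> U \<and>
      (\<forall>x\<in>V. \<forall>y\<in>V. \<forall>u\<ge>0. \<forall>v\<ge>0. u + v = 1 \<longrightarrow> u *\<^sub>R x + v *\<^sub>R y \<in> V)"

lemma convex_neighbourhood:
  fixes U :: "'a::locally_convex set"
  assumes "open U" "0 \<in> U"
  obtains V where "open V" "convex V" "0 \<in> V" "V \<subseteq> U"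
  using convex_neighbourhoods[OF assms] by (metis convex_def)

instance real_normed_vector \<subseteq> locally_convex
proof
  fix r :: real and a :: 'a
  show "LIM x (nhds r \<times>\<^sub>F nhds a). fst x *\<^sub>R snd x :> nhds (r *\<^sub>R a)"
    by (intro tendsto_scaleR filterlim_fst filterlim_snd)
next
  fix U :: "'a set"
  assume "open U" "0 \<in> U"
  then obtain e where "e > 0" "ball 0 e \<subseteq> U"
    using open_contains_ball by blast
  moreover have "convex (ball (0::'a) e)"
    by simp
  ultimately show "\<exists>V. open V \<and> 0 \<in> V \<and> V \<subseteq> U \<and>
      (\<forall>x\<in>V. \<forall>y\<in>V. \<forall>u\<ge>0. \<forall>v\<ge>0. u + v = 1 \<longrightarrow> u *\<^sub>R x + v *\<^sub>R y \<in> V)"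
    unfolding convex_def by (intro exI[of _ "ball 0 e"]) simp
qed

instance prod :: (topological_monoid_add, topological_monoid_add) topological_monoid_add
proof
  fix a b :: "'a \<times> 'b"
  have f: "((\<lambda>x. fst x) \<longlongrightarrow> a) (nhds a \<times>\<^sub>F nhds b)" "((\<lambda>x. snd x) \<longlongrightarrow> b) (nhds a \<times>\<^sub>F nhds b)"
    by (intro filterlim_fst filterlim_snd)+
  show "LIM x (nhds a \<times>\<^sub>F nhds b). fst x + snd x :> nhds (a + b)"
    unfolding plus_prod_def by (intro tendsto_intros f)
qed

instance prod :: (topological_group_add, topological_group_add) topological_group_add
proof
  fix a :: "'a \<times> 'b"
  show "(uminus \<longlongrightarrow> - a) (nhds a)"
    unfolding uminus_prod_def by (intro tendsto_intros filterlim_ident)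
qed

instance prod :: (topological_ab_group_add, topological_ab_group_add) topological_ab_group_add ..

instance prod :: (locally_convex, locally_convex) locally_convex
proof
  fix r :: real and a :: "'a \<times> 'b"
  have f: "((\<lambda>x. fst x) \<longlongrightarrow> r) (nhds r \<times>\<^sub>F nhds a)" "((\<lambda>x. snd x) \<longlongrightarrow> a) (nhds r \<times>\<^sub>F nhds a)"
    by (intro filterlim_fst filterlim_snd)+
  have *: "((\<lambda>x. fst x *\<^sub>R g (snd x)) \<longlongrightarrow> r *\<^sub>R g a) (nhds r \<times>\<^sub>F nhds a)"
    if "((\<lambda>x. g (snd x)) \<longlongrightarrow> g a) (nhds r \<times>\<^sub>F nhds a)" for g :: "'a \<times> 'b \<Rightarrow> 'c::locally_convex"
    using filterlim_compose[OF tendsto_scaleR_Pair[of r "g a"] filterlim_Pair[OF f(1) that]]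
    by simp
  show "LIM x (nhds r \<times>\<^sub>F nhds a). fst x *\<^sub>R snd x :> nhds (r *\<^sub>R a)"
    unfolding scaleR_prod_def by (intro tendsto_Pair * tendsto_fst tendsto_snd f)
next
  fix U :: "('a \<times> 'b) set"
  assume "open U" "0 \<in> U"
  then obtain A B where AB: "open A" "open B" "0 \<in> A \<times> B" "A \<times> B \<subseteq> U"
    by (rule open_prod_elim)
  have "0 \<in> A" "0 \<in> B"
    using AB(3) by (simp_all add: zero_prod_def)
  obtain A' where A': "open A'" "convex A'" "0 \<in> A'" "A' \<subseteq> A"
    using convex_neighbourhood[OF AB(1) \<open>0 \<in> A\<close>] by blast
  obtain B' where B': "open B'" "convex B'" "0 \<in> B'" "B' \<subseteq> B"
    using convex_neighbourhood[OF AB(2) \<open>0 \<in> B\<close>] by blast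
  have "open (A' \<times> B')" "0 \<in> A' \<times> B'"
    using A' B' by (simp_all add: open_Times zero_prod_def)
  moreover have "A' \<times> B' \<subseteq> U"
    using A'(4) B'(4) AB(4) by blast
  moreover have "\<forall>x\<in>A' \<times> B'. \<forall>y\<in>A' \<times> B'. \<forall>u\<ge>0. \<forall>v\<ge>0. u + v = 1 \<longrightarrow> u *\<^sub>R x + v *\<^sub>R y \<in> A' \<times> B'"
    using convex_Times[OF A'(2) B'(2)] by (simp only: convex_def)
  ultimately show "\<exists>V. open V \<and> 0 \<in> V \<and> V \<subseteq> U \<and>
      (\<forall>x\<in>V. \<forall>y\<in>V. \<forall>u\<ge>0. \<forall>v\<ge>0. u + v = 1 \<longrightarrow> u *\<^sub>R x + v *\<^sub>R y \<in> V)"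
    by (intro exI[of _ "A' \<times> B'"] conjI)
qed

definition has_dirderiv :: "('e::locally_convex \<Rightarrow> 'f::locally_convex) \<Rightarrow> 'e \<Rightarrow> 'e \<Rightarrow> 'f \<Rightarrow> bool" where
  "has_dirderiv f x v l \<longleftrightarrow> ((\<lambda>t::real. (f (x + t *\<^sub>R v) - f x) /\<^sub>R t) \<longlongrightarrow> l) (at 0)"

definition dirderiv :: "('e::locally_convex \<Rightarrow> 'f::locally_convex) \<Rightarrow> 'e \<Rightarrow> 'e \<Rightarrow> 'f" where
  "dirderiv f x v = Lim (at 0) (\<lambda>t::real. (f (x + t *\<^sub>R v) - f x) /\<^sub>R t)"

primrec dirderivs :: "nat \<Rightarrow> ('e::locally_convex \<Rightarrow> 'f::locally_convex) \<Rightarrow> (nat \<Rightarrow> 'e) \<Rightarrow> 'e \<Rightarrow> 'f" where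
  "dirderivs 0 f v = f"
| "dirderivs (Suc k) f v = (\<lambda>x. dirderiv (dirderivs k f v) x (v k))"

text \<open>
  Smoothness in the sense of Michal--Bastiani on an open set \<open>U\<close>: all iterated directional
  derivatives \<open>d\<^sup>k f (x; v\<^sub>0, \<dots>)\<close> exist and are continuous in \<open>x\<close> and the directions jointly.
  The \<open>k\<close> directions are the first \<open>k\<close> members of a sequence \<open>v\<close>; as \<open>dirderivs k f v\<close> depends
  on no other members, continuity for the product topology on sequences is the same as
  continuity in \<open>(x, v 0, \<dots>, v (k - 1))\<close>.
\<close>

definition smooth_on :: "'e::locally_convex set \<Rightarrow> ('e \<Rightarrow> 'f::locally_convex) \<Rightarrow> bool" where
  "smooth_on U f \<longleftrightarrow> (\<forall>k.
     (\<forall>v. \<forall>x\<in>U. \<exists>l. has_dirderiv (dirderivs k f v) x (v k) l) \<and>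
     continuous_on (U \<times> UNIV) (\<lambda>(x, v). dirderivs k f v x))"

definition continuous_linear :: "('e::locally_convex \<Rightarrow> 'f::locally_convex) \<Rightarrow> bool" where
  "continuous_linear f \<longleftrightarrow> linear f \<and> continuous_on UNIV f"

definition continuous_bilinear ::
  "('e::locally_convex \<Rightarrow> 'f::locally_convex \<Rightarrow> 'h::locally_convex) \<Rightarrow> bool" where
  "continuous_bilinear f \<longleftrightarrow>
     (\<forall>x. linear (f x)) \<and> (\<forall>y. linear (\<lambda>x. f x y)) \<and> continuous_on UNIV (\<lambda>(x, y). f x y)"


section \<open>Manifolds\<close>

text \<open>
  A manifold is a Hausdorff space, given as a type, with a smooth atlas modeled on a locally
  convex space. The atlas need not be maximal, since no notion below depends on its choice
  within a smooth structure.
\<close>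

type_synonym ('m, 'e) chart = "'m set \<times> ('m \<Rightarrow> 'e)"

definition chart_inv :: "('m, 'e) chart \<Rightarrow> 'e \<Rightarrow> 'm" where
  "chart_inv c = inv_into (fst c) (snd c)"

definition chart_image :: "('m, 'e) chart \<Rightarrow> 'e set" where
  "chart_image c = snd c ` fst c"

definition manifold :: "('m::t2_space, 'e::locally_convex) chart set \<Rightarrow> bool" where
  "manifold A \<longleftrightarrow>
     (\<Union>c\<in>A. fst c) = UNIV \<and>
     (\<forall>c\<in>A. open (fst c) \<and> open (chart_image c) \<and>
        homeomorphism (fst c) (chart_image c) (snd c) (chart_inv c)) \<and>
     (\<forall>c\<in>A. \<forall>d\<in>A. smooth_on (snd c ` (fst c \<inter> fst d)) (snd d \<circ> chart_inv c))"

definition prod_atlas ::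
  "('m::t2_space, 'e::locally_convex) chart set \<Rightarrow> ('n::t2_space, 'f::locally_convex) chart set \<Rightarrow>
   ('m \<times> 'n, 'e \<times> 'f) chart set" where
  "prod_atlas A B = {(fst c \<times> fst d, map_prod (snd c) (snd d)) | c d. c \<in> A \<and> d \<in> B}"

definition vec_atlas :: "('v::locally_convex, 'v) chart set" where
  "vec_atlas = {(UNIV, \<lambda>x. x)}"

definition smooth_map_on ::
  "('m::t2_space, 'e::locally_convex) chart set \<Rightarrow> ('n::t2_space, 'f::locally_convex) chart set \<Rightarrow>
   'm set \<Rightarrow> ('m \<Rightarrow> 'n) \<Rightarrow> bool" where
  "smooth_map_on A B S f \<longleftrightarrow> continuous_on S f \<and>
     (\<forall>c\<in>A. \<forall>d\<in>B. smooth_on (snd c ` (fst c \<inter> S \<inter> f -` fst d)) (snd d \<circ> f \<circ> chart_inv c))"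

abbreviation smooth_map ::
  "('m::t2_space, 'e::locally_convex) chart set \<Rightarrow> ('n::t2_space, 'f::locally_convex) chart set \<Rightarrow>
   ('m \<Rightarrow> 'n) \<Rightarrow> bool" where
  "smooth_map A B f \<equiv> smooth_map_on A B UNIV f"

text \<open>
  Tangent spaces: at every point \<open>p\<close> one chart \<open>chart_at A p\<close> is chosen, and \<open>T\<^sub>p M\<close> is the model
  space \<open>'e\<close>, a vector standing for its coordinates in that chart. \<open>to_chart\<close> and \<open>from_chart\<close> convert
  between these and the coordinates in another chart around \<open>p\<close>. A section of a bundle built from
  the tangent bundle is smooth if its expression in the coordinates of every chart is.
\<close>

definition chart_at :: "('m, 'e) chart set \<Rightarrow> 'm \<Rightarrow> ('m, 'e) chart" where
  "chart_at A p = (SOME c. c \<in> A \<and> p \<in> fst c)"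

definition tangent_map ::
  "('m::t2_space, 'e::locally_convex) chart set \<Rightarrow> ('n::t2_space, 'f::locally_convex) chart set \<Rightarrow>
   ('m \<Rightarrow> 'n) \<Rightarrow> 'm \<Rightarrow> 'e \<Rightarrow> 'f" where
  "tangent_map A B f p =
     dirderiv (snd (chart_at B (f p)) \<circ> f \<circ> chart_inv (chart_at A p)) (snd (chart_at A p) p)"

definition to_chart ::
  "('m, 'e::locally_convex) chart set \<Rightarrow> ('m, 'e) chart \<Rightarrow> 'm \<Rightarrow> 'e \<Rightarrow> 'e" where
  "to_chart A c p = dirderiv (snd c \<circ> chart_inv (chart_at A p)) (snd (chart_at A p) p)"

definition from_chart ::
  "('m, 'e::locally_convex) chart set \<Rightarrow> ('m, 'e) chart \<Rightarrow> 'm \<Rightarrow> 'e \<Rightarrow> 'e" where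
  "from_chart A c p = dirderiv (snd (chart_at A p) \<circ> chart_inv c) (snd c p)"


subsection \<open>Vector fields\<close>

definition field_rep ::
  "('m, 'e::locally_convex) chart set \<Rightarrow> ('m \<Rightarrow> 'e) \<Rightarrow> ('m, 'e) chart \<Rightarrow> 'e \<Rightarrow> 'e" where
  "field_rep A X c x = to_chart A c (chart_inv c x) (X (chart_inv c x))"

definition smooth_field :: "('m, 'e::locally_convex) chart set \<Rightarrow> ('m \<Rightarrow> 'e) \<Rightarrow> bool" where
  "smooth_field A X \<longleftrightarrow> (\<forall>c\<in>A. smooth_on (chart_image c) (field_rep A X c))"

definition field_bracket ::
  "('m, 'e::locally_convex) chart set \<Rightarrow> ('m \<Rightarrow> 'e) \<Rightarrow> ('m \<Rightarrow> 'e) \<Rightarrow> 'm \<Rightarrow> 'e" where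
  "field_bracket A X Y p = (let c = chart_at A p; x = snd c p in
     dirderiv (field_rep A Y c) x (X p) - dirderiv (field_rep A X c) x (Y p))"

text \<open>The velocity of a curve \<open>\<gamma>\<close> at \<open>t\<close>, one-sided at the end points of an interval \<open>S\<close>.\<close>

definition has_velocity ::
  "('m, 'e::locally_convex) chart set \<Rightarrow> (real \<Rightarrow> 'm) \<Rightarrow> real \<Rightarrow> real set \<Rightarrow> 'e \<Rightarrow> bool" where
  "has_velocity A \<gamma> t S v \<longleftrightarrow> (let \<phi> = snd (chart_at A (\<gamma> t)) in
     ((\<lambda>s. (\<phi> (\<gamma> s) - \<phi> (\<gamma> t)) /\<^sub>R (s - t)) \<longlongrightarrow> v) (at t within S))"

definition integral_curve ::
  "('m::t2_space, 'e::locally_convex) chart set \<Rightarrow> ('m \<Rightarrow> 'e) \<Rightarrow> real \<Rightarrow> (real \<Rightarrow> 'm) \<Rightarrow> bool" where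
  "integral_curve A X \<delta> \<gamma> \<longleftrightarrow> 0 < \<delta> \<and> continuous_on {0..\<delta>} \<gamma> \<and>
     (\<forall>t\<in>{0..\<delta>}. has_velocity A \<gamma> t {0..\<delta>} (X (\<gamma> t)))"


subsection \<open>Forms and tensors\<close>

definition form1_rep ::
  "('m, 'e::locally_convex) chart set \<Rightarrow> ('m \<Rightarrow> 'e \<Rightarrow> 'v) \<Rightarrow> ('m, 'e) chart \<Rightarrow> 'e \<Rightarrow> 'e \<Rightarrow> 'v" where
  "form1_rep A \<alpha> c x v = \<alpha> (chart_inv c x) (from_chart A c (chart_inv c x) v)"

definition smooth_1form ::
  "('m, 'e::locally_convex) chart set \<Rightarrow> ('m \<Rightarrow> 'e \<Rightarrow> 'v::locally_convex) \<Rightarrow> bool" where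
  "smooth_1form A \<alpha> \<longleftrightarrow> (\<forall>p. linear (\<alpha> p)) \<and>
     (\<forall>c\<in>A. smooth_on (chart_image c \<times> UNIV) (\<lambda>(x, v). form1_rep A \<alpha> c x v))"

definition ext_deriv1 ::
  "('m, 'e::locally_convex) chart set \<Rightarrow> ('m \<Rightarrow> 'e \<Rightarrow> 'v::locally_convex) \<Rightarrow> 'm \<Rightarrow> 'e \<Rightarrow> 'e \<Rightarrow> 'v" where
  "ext_deriv1 A \<alpha> p X Y = (let c = chart_at A p; x = snd c p in
     dirderiv (\<lambda>y. form1_rep A \<alpha> c y Y) x X - dirderiv (\<lambda>y. form1_rep A \<alpha> c y X) x Y)"

definition form2_rep ::
  "('m, 'e::locally_convex) chart set \<Rightarrow> ('m \<Rightarrow> 'e \<Rightarrow> 'e \<Rightarrow> 'v) \<Rightarrow> ('m, 'e) chart \<Rightarrow>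
   'e \<Rightarrow> 'e \<Rightarrow> 'e \<Rightarrow> 'v" where
  "form2_rep A \<omega> c x v w = (let p = chart_inv c x in
     \<omega> p (from_chart A c p v) (from_chart A c p w))"

definition smooth_bilinear_form ::
  "('m, 'e::locally_convex) chart set \<Rightarrow> ('m \<Rightarrow> 'e \<Rightarrow> 'e \<Rightarrow> real) \<Rightarrow> bool" where
  "smooth_bilinear_form A \<omega> \<longleftrightarrow>
     (\<forall>p X. linear (\<omega> p X)) \<and> (\<forall>p Y. linear (\<lambda>X. \<omega> p X Y)) \<and>
     (\<forall>c\<in>A. smooth_on (chart_image c \<times> UNIV) (\<lambda>(x, v, w). form2_rep A \<omega> c x v w))"

definition ext_deriv2 ::
  "('m, 'e::locally_convex) chart set \<Rightarrow> ('m \<Rightarrow> 'e \<Rightarrow> 'e \<Rightarrow> real) \<Rightarrow> 'm \<Rightarrow> 'e \<Rightarrow> 'e \<Rightarrow> 'e \<Rightarrow> real" where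
  "ext_deriv2 A \<omega> p X Y Z = (let c = chart_at A p; x = snd c p in
     dirderiv (\<lambda>y. form2_rep A \<omega> c y Y Z) x X
     - dirderiv (\<lambda>y. form2_rep A \<omega> c y X Z) x Y
     + dirderiv (\<lambda>y. form2_rep A \<omega> c y X Y) x Z)"

text \<open>
  Non-degeneracy is the weak one, i.e. injectivity of \<open>X \<mapsto> \<omega>(X, \<cdot>)\<close>. Likewise a Riemannian metric
  is only required to be positive definite and need not induce the topology of the tangent spaces.
\<close>

definition symplectic_form ::
  "('m::t2_space, 'e::locally_convex) chart set \<Rightarrow> ('m \<Rightarrow> 'e \<Rightarrow> 'e \<Rightarrow> real) \<Rightarrow> bool" where
  "symplectic_form A \<omega> \<longleftrightarrow> smooth_bilinear_form A \<omega> \<and> (\<forall>p X. \<omega> p X X = 0) \<and>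
     (\<forall>p X Y Z. ext_deriv2 A \<omega> p X Y Z = 0) \<and>
     (\<forall>p X. (\<forall>Y. \<omega> p X Y = 0) \<longrightarrow> X = 0)"

definition riemannian_metric ::
  "('m::t2_space, 'e::locally_convex) chart set \<Rightarrow> ('m \<Rightarrow> 'e \<Rightarrow> 'e \<Rightarrow> real) \<Rightarrow> bool" where
  "riemannian_metric A h \<longleftrightarrow> smooth_bilinear_form A h \<and> (\<forall>p X Y. h p X Y = h p Y X) \<and>
     (\<forall>p X. X \<noteq> 0 \<longrightarrow> h p X X > 0)"

definition riemannian_norm :: "('m \<Rightarrow> 'e \<Rightarrow> 'e \<Rightarrow> real) \<Rightarrow> 'm \<Rightarrow> 'e \<Rightarrow> real" where
  "riemannian_norm h p X = sqrt (h p X X)"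

definition almost_complex ::
  "('m::t2_space, 'e::locally_convex) chart set \<Rightarrow> ('m \<Rightarrow> 'e \<Rightarrow> 'e) \<Rightarrow> bool" where
  "almost_complex A j \<longleftrightarrow> (\<forall>p. linear (j p)) \<and> (\<forall>p X. j p (j p X) = - X) \<and>
     (\<forall>c\<in>A. smooth_on (chart_image c \<times> UNIV)
        (\<lambda>(x, v). let p = chart_inv c x in to_chart A c p (j p (from_chart A c p v))))"

definition compatible_metric :: "('m \<Rightarrow> 'e \<Rightarrow> 'e \<Rightarrow> real) \<Rightarrow> ('m \<Rightarrow> 'e \<Rightarrow> 'e) \<Rightarrow> 'm \<Rightarrow> 'e \<Rightarrow> 'e \<Rightarrow> real" where
  "compatible_metric \<omega> j p X Y = \<omega> p X (j p Y)"


section \<open>Lie groups and Klein pairs\<close>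

definition lie_group :: "('g::t2_space) monoid \<Rightarrow> ('g, 'l::locally_convex) chart set \<Rightarrow> bool" where
  "lie_group G AG \<longleftrightarrow> manifold AG \<and> group G \<and> carrier G = UNIV \<and>
     smooth_map (prod_atlas AG AG) AG (\<lambda>(g, h). g \<otimes>\<^bsub>G\<^esub> h) \<and>
     smooth_map AG AG (\<lambda>g. inv\<^bsub>G\<^esub> g)"

definition smooth_action ::
  "('g::t2_space) monoid \<Rightarrow> ('g, 'l::locally_convex) chart set \<Rightarrow>
   ('m::t2_space, 'e::locally_convex) chart set \<Rightarrow> ('g \<Rightarrow> 'm \<Rightarrow> 'm) \<Rightarrow> bool" where
  "smooth_action G AG AM act \<longleftrightarrow>
     (\<forall>m. act \<one>\<^bsub>G\<^esub> m = m) \<and> (\<forall>g h m. act (g \<otimes>\<^bsub>G\<^esub> h) m = act g (act h m)) \<and>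
     smooth_map (prod_atlas AG AM) AM (\<lambda>(g, m). act g m)"

text \<open>
  The Lie algebra of \<open>G\<close> is \<open>T\<^sub>e G\<close>, i.e. the type \<open>'l\<close>, with the bracket of left-invariant vector
  fields. \<open>fundamental_field\<close> is the infinitesimal left action \<open>\<xi> \<mapsto> \<xi>\<^sup>* = d/dt exp(t \<xi>) \<cdot> m\<close>, written
  without an exponential map.
\<close>

definition left_invariant_field ::
  "('g::t2_space) monoid \<Rightarrow> ('g, 'l::locally_convex) chart set \<Rightarrow> 'l \<Rightarrow> 'g \<Rightarrow> 'l" where
  "left_invariant_field G AG x g = tangent_map AG AG (\<lambda>h. g \<otimes>\<^bsub>G\<^esub> h) \<one>\<^bsub>G\<^esub> x"

definition group_bracket ::
  "('g::t2_space) monoid \<Rightarrow> ('g, 'l::locally_convex) chart set \<Rightarrow> 'l \<Rightarrow> 'l \<Rightarrow> 'l" where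
  "group_bracket G AG x y =
     field_bracket AG (left_invariant_field G AG x) (left_invariant_field G AG y) \<one>\<^bsub>G\<^esub>"

definition adjoint_rep ::
  "('g::t2_space) monoid \<Rightarrow> ('g, 'l::locally_convex) chart set \<Rightarrow> 'g \<Rightarrow> 'l \<Rightarrow> 'l" where
  "adjoint_rep G AG g = tangent_map AG AG (\<lambda>h. g \<otimes>\<^bsub>G\<^esub> h \<otimes>\<^bsub>G\<^esub> inv\<^bsub>G\<^esub> g) \<one>\<^bsub>G\<^esub>"

definition fundamental_field ::
  "('g::t2_space) monoid \<Rightarrow> ('g, 'l::locally_convex) chart set \<Rightarrow>
   ('m::t2_space, 'e::locally_convex) chart set \<Rightarrow> ('g \<Rightarrow> 'm \<Rightarrow> 'm) \<Rightarrow> 'l \<Rightarrow> 'm \<Rightarrow> 'e" where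
  "fundamental_field G AG AM act x m = tangent_map AG AM (\<lambda>g. act g m) \<one>\<^bsub>G\<^esub> x"

definition lie_algebra :: "('a::locally_convex \<Rightarrow> 'a \<Rightarrow> 'a) \<Rightarrow> bool" where
  "lie_algebra br \<longleftrightarrow> continuous_bilinear br \<and> (\<forall>x. br x x = 0) \<and>
     (\<forall>x y z. br x (br y z) + br y (br z x) + br z (br x y) = 0)"

definition complemented :: "'a::locally_convex set \<Rightarrow> bool" where
  "complemented S \<longleftrightarrow> (\<exists>K. subspace K \<and> closed K \<and>
     (\<exists>h. homeomorphism (S \<times> K) UNIV (\<lambda>(s, k). s + k) h))"

text \<open>
  The subalgebra \<open>\<gg> \<subseteq> \<aa>\<close> is the range of \<open>\<iota>\<close>, which identifies it, as a topological Lie algebra,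
  with the Lie algebra \<open>T\<^sub>e G\<close> of \<open>G\<close>; \<open>abr\<close> is the bracket of \<open>\<aa>\<close>.
\<close>

definition klein_pair ::
  "('g::t2_space) monoid \<Rightarrow> ('g, 'l::locally_convex) chart set \<Rightarrow>
   ('a::locally_convex \<Rightarrow> 'a \<Rightarrow> 'a) \<Rightarrow> ('l \<Rightarrow> 'a) \<Rightarrow> ('g \<Rightarrow> 'a \<Rightarrow> 'a) \<Rightarrow> bool" where
  "klein_pair G AG abr \<iota> Ad \<longleftrightarrow> lie_group G AG \<and> lie_algebra abr \<and>
     linear \<iota> \<and> homeomorphism UNIV (range \<iota>) \<iota> (inv_into UNIV \<iota>) \<and>
     (\<forall>x y. \<iota> (group_bracket G AG x y) = abr (\<iota> x) (\<iota> y)) \<and>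
     closed (range \<iota>) \<and> complemented (range \<iota>) \<and>
     (\<forall>g. continuous_linear (Ad g)) \<and> smooth_action G AG vec_atlas Ad \<and>
     (\<forall>g x. Ad g (\<iota> x) = \<iota> (adjoint_rep G AG g x))"


section \<open>Cartan geometries and orbits\<close>

definition principal_bundle ::
  "('g::t2_space) monoid \<Rightarrow> ('g, 'l::locally_convex) chart set \<Rightarrow>
   ('p::t2_space, 'f::locally_convex) chart set \<Rightarrow> ('b::t2_space, 'h::locally_convex) chart set \<Rightarrow>
   ('g \<Rightarrow> 'p \<Rightarrow> 'p) \<Rightarrow> ('p \<Rightarrow> 'b) \<Rightarrow> bool" where
  "principal_bundle G AG AP AB act \<pi> \<longleftrightarrow>
     lie_group G AG \<and> manifold AP \<and> manifold AB \<and> smooth_action G AG AP act \<and>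
     smooth_map AP AB \<pi> \<and> (\<forall>g p. \<pi> (act g p) = \<pi> p) \<and>
     (\<forall>b. \<exists>U \<tau>. open U \<and> b \<in> U \<and> smooth_map_on AP AG (\<pi> -` U) \<tau> \<and>
        (\<forall>p\<in>\<pi> -` U. \<forall>g. \<tau> (act g p) = g \<otimes>\<^bsub>G\<^esub> \<tau> p) \<and>
        bij_betw (\<lambda>p. (\<pi> p, \<tau> p)) (\<pi> -` U) (U \<times> UNIV) \<and>
        smooth_map_on (prod_atlas AB AG) AP (U \<times> UNIV) (inv_into (\<pi> -` U) (\<lambda>p. (\<pi> p, \<tau> p))))"

definition cartan_field :: "('p \<Rightarrow> 'f \<Rightarrow> 'a) \<Rightarrow> 'a \<Rightarrow> 'p \<Rightarrow> 'f" where
  "cartan_field \<theta> \<xi> p = inv_into UNIV (\<theta> p) \<xi>"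

text \<open>
  Over general locally convex spaces, smoothness of the fields \<open>\<theta>\<inverse>(\<xi>)\<close> does not follow from
  \<open>\<theta>\<^sub>p\<close> being an isomorphism for each \<open>p\<close>, so it is listed as part of the structure.
\<close>

definition cartan_geometry ::
  "('g::t2_space) monoid \<Rightarrow> ('g, 'l::locally_convex) chart set \<Rightarrow>
   ('p::t2_space, 'f::locally_convex) chart set \<Rightarrow> ('b::t2_space, 'h::locally_convex) chart set \<Rightarrow>
   ('l \<Rightarrow> 'a::locally_convex) \<Rightarrow> ('g \<Rightarrow> 'a \<Rightarrow> 'a) \<Rightarrow>
   ('g \<Rightarrow> 'p \<Rightarrow> 'p) \<Rightarrow> ('p \<Rightarrow> 'b) \<Rightarrow> ('p \<Rightarrow> 'f \<Rightarrow> 'a) \<Rightarrow> bool" where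
  "cartan_geometry G AG AP AB \<iota> Ad act \<pi> \<theta> \<longleftrightarrow>
     principal_bundle G AG AP AB act \<pi> \<and> smooth_1form AP \<theta> \<and>
     (\<forall>p. homeomorphism UNIV UNIV (\<theta> p) (\<lambda>\<xi>. cartan_field \<theta> \<xi> p)) \<and>
     (\<forall>\<xi>. smooth_field AP (cartan_field \<theta> \<xi>)) \<and>
     (\<forall>g p X. \<theta> (act g p) (tangent_map AP AP (act g) p X) = Ad g (\<theta> p X)) \<and>
     (\<forall>x p. \<theta> p (fundamental_field G AG AP act x p) = \<iota> x)"

definition torsion_free ::
  "('p, 'f::locally_convex) chart set \<Rightarrow> ('a::locally_convex \<Rightarrow> 'a \<Rightarrow> 'a) \<Rightarrow> ('l \<Rightarrow> 'a) \<Rightarrow>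
   ('p \<Rightarrow> 'f \<Rightarrow> 'a) \<Rightarrow> bool" where
  "torsion_free AP abr \<iota> \<theta> \<longleftrightarrow>
     (\<forall>p X Y. ext_deriv1 AP \<theta> p X Y - abr (\<theta> p X) (\<theta> p Y) \<in> range \<iota>)"

text \<open>
  A right Lie algebra action is a homomorphism into the vector fields that is smooth as a map
  \<open>\<aa>\<^sub>m \<times> P \<rightarrow> TP\<close>. As it is linear in the first argument, this means that the derivatives in the
  direction of \<open>P\<close> exist and are jointly continuous, which makes sense on the subspace \<open>\<aa>\<^sub>m\<close>.
\<close>

definition right_lie_algebra_action ::
  "('p::t2_space, 'f::locally_convex) chart set \<Rightarrow> ('a::locally_convex \<Rightarrow> 'a \<Rightarrow> 'a) \<Rightarrow> 'a set \<Rightarrow>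
   ('a \<Rightarrow> 'p \<Rightarrow> 'f) \<Rightarrow> bool" where
  "right_lie_algebra_action AP abr S star \<longleftrightarrow>
     (\<forall>\<zeta>\<in>S. smooth_field AP (star \<zeta>)) \<and>
     (\<forall>\<zeta>\<in>S. \<forall>\<eta>\<in>S. \<forall>r s p. star (r *\<^sub>R \<zeta> + s *\<^sub>R \<eta>) p = r *\<^sub>R star \<zeta> p + s *\<^sub>R star \<eta> p) \<and>
     (\<forall>\<zeta>\<in>S. \<forall>\<eta>\<in>S. \<forall>p. star (abr \<zeta> \<eta>) p = field_bracket AP (star \<zeta>) (star \<eta>) p) \<and>
     (\<forall>c\<in>AP. \<forall>k. continuous_on (S \<times> chart_image c \<times> UNIV)
        (\<lambda>(\<zeta>, x, v). dirderivs k (field_rep AP (star \<zeta>) c) v x))"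

definition orbit_through ::
  "('p::t2_space, 'f::locally_convex) chart set \<Rightarrow> ('m::t2_space, 'e::locally_convex) chart set \<Rightarrow>
   ('a::locally_convex \<Rightarrow> 'a \<Rightarrow> 'a) \<Rightarrow> ('g \<Rightarrow> 'p \<Rightarrow> 'p) \<Rightarrow> ('g \<Rightarrow> 'm \<Rightarrow> 'm) \<Rightarrow>
   ('p \<Rightarrow> 'm) \<Rightarrow> 'm \<Rightarrow> bool" where
  "orbit_through AP AM abr actP actM chi m \<longleftrightarrow>
     smooth_map AP AM chi \<and> (\<forall>g p. chi (actP g p) = actM g (chi p)) \<and> m \<in> range chi \<and>
     (\<exists>S star. subspace S \<and> (\<forall>\<zeta>\<in>S. \<forall>\<eta>\<in>S. abr \<zeta> \<eta> \<in> S) \<and>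
        right_lie_algebra_action AP abr S star \<and>
        (\<forall>\<zeta>\<in>S. \<forall>g p. tangent_map AP AP (actP g) p (star \<zeta> p) = star \<zeta> (actP g p)) \<and>
        (\<forall>\<zeta>\<in>S. \<forall>p. tangent_map AP AM chi p (star \<zeta> p) = 0))"

definition inf_action ::
  "('p::t2_space, 'f::locally_convex) chart set \<Rightarrow> ('m::t2_space, 'e::locally_convex) chart set \<Rightarrow>
   ('p \<Rightarrow> 'f \<Rightarrow> 'a) \<Rightarrow> ('p \<Rightarrow> 'm) \<Rightarrow> 'a \<Rightarrow> 'p \<Rightarrow> 'e" where
  "inf_action AP AM \<theta> chi \<xi> p = tangent_map AP AM chi p (cartan_field \<theta> \<xi> p)"


section \<open>Momentum maps\<close>

text \<open>
  \<open>\<gg>\<^sup>*\<close> is the type \<open>'d\<close>. The map \<open>coAd g\<close> is \<open>Ad\<^sup>*\<^sub>g\<close>, the adjoint of \<open>Ad\<^sub>g\<close> with respect to \<open>\<kappa>\<close>, so that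
  \<open>g \<mapsto> Ad\<^sup>*\<^sub>g\<^sub>\<inverse>\<close> is the left coadjoint action.
\<close>

definition nondegenerate_pairing ::
  "('d::locally_convex \<Rightarrow> 'l::locally_convex \<Rightarrow> real) \<Rightarrow> bool" where
  "nondegenerate_pairing \<kappa> \<longleftrightarrow> continuous_bilinear \<kappa> \<and>
     (\<forall>\<mu>. (\<forall>x. \<kappa> \<mu> x = 0) \<longrightarrow> \<mu> = 0) \<and> (\<forall>x. (\<forall>\<mu>. \<kappa> \<mu> x = 0) \<longrightarrow> x = 0)"

definition coadjoint_map ::
  "('g::t2_space) monoid \<Rightarrow> ('g, 'l::locally_convex) chart set \<Rightarrow>
   ('d::locally_convex \<Rightarrow> 'l \<Rightarrow> real) \<Rightarrow> ('g \<Rightarrow> 'd \<Rightarrow> 'd) \<Rightarrow> bool" where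
  "coadjoint_map G AG \<kappa> coAd \<longleftrightarrow> (\<forall>g. continuous_linear (coAd g)) \<and>
     (\<forall>g \<mu> x. \<kappa> (coAd g \<mu>) x = \<kappa> \<mu> (adjoint_rep G AG g x))"

definition symplectic_action ::
  "('g::t2_space) monoid \<Rightarrow> ('g, 'l::locally_convex) chart set \<Rightarrow>
   ('m::t2_space, 'e::locally_convex) chart set \<Rightarrow> ('m \<Rightarrow> 'e \<Rightarrow> 'e \<Rightarrow> real) \<Rightarrow>
   ('g \<Rightarrow> 'm \<Rightarrow> 'm) \<Rightarrow> bool" where
  "symplectic_action G AG AM \<omega> act \<longleftrightarrow> smooth_action G AG AM act \<and>
     (\<forall>g m X Y. \<omega> (act g m) (tangent_map AM AM (act g) m X) (tangent_map AM AM (act g) m Y) = \<omega> m X Y)"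

definition momentum_map ::
  "('g::t2_space) monoid \<Rightarrow> ('g, 'l::locally_convex) chart set \<Rightarrow>
   ('m::t2_space, 'e::locally_convex) chart set \<Rightarrow> ('m \<Rightarrow> 'e \<Rightarrow> 'e \<Rightarrow> real) \<Rightarrow>
   ('g \<Rightarrow> 'm \<Rightarrow> 'm) \<Rightarrow> ('d::locally_convex \<Rightarrow> 'l \<Rightarrow> real) \<Rightarrow> ('m \<Rightarrow> 'd) \<Rightarrow> bool" where
  "momentum_map G AG AM \<omega> act \<kappa> J \<longleftrightarrow> smooth_map AM vec_atlas J \<and>
     (\<forall>m X x. \<omega> m (fundamental_field G AG AM act x m) X
        + \<kappa> (tangent_map AM vec_atlas J m X) x = 0)"

definition nonequivariance_cocycle ::
  "('g::t2_space) monoid \<Rightarrow> ('g \<Rightarrow> 'm \<Rightarrow> 'm) \<Rightarrow> ('g \<Rightarrow> 'd::locally_convex \<Rightarrow> 'd) \<Rightarrow>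
   ('m \<Rightarrow> 'd) \<Rightarrow> ('g \<Rightarrow> 'd) \<Rightarrow> bool" where
  "nonequivariance_cocycle G act coAd J \<sigma> \<longleftrightarrow>
     (\<forall>g m. J (act g m) = coAd (inv\<^bsub>G\<^esub> g) (J m) + \<sigma> g)"

definition duality ::
  "('g::t2_space) monoid \<Rightarrow> ('l \<Rightarrow> 'a::locally_convex) \<Rightarrow> ('g \<Rightarrow> 'a \<Rightarrow> 'a) \<Rightarrow>
   ('g \<Rightarrow> 'd::locally_convex \<Rightarrow> 'd) \<Rightarrow> ('d \<Rightarrow> 'a \<Rightarrow> real) \<Rightarrow> bool" where
  "duality G \<iota> Ad coAd \<kappa>a \<longleftrightarrow> continuous_bilinear \<kappa>a \<and>
     (\<forall>g \<mu> \<xi>. \<kappa>a (coAd (inv\<^bsub>G\<^esub> g) \<mu>) (Ad g \<xi>) = \<kappa>a \<mu> \<xi>) \<and> (\<forall>\<mu> x. \<kappa>a \<mu> (\<iota> x) = 0)"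

definition calabi ::
  "('p::t2_space, 'f::locally_convex) chart set \<Rightarrow> ('m::t2_space, 'e::locally_convex) chart set \<Rightarrow>
   ('p \<Rightarrow> 'f \<Rightarrow> 'a) \<Rightarrow> ('p \<Rightarrow> 'm) \<Rightarrow> ('m \<Rightarrow> 'd::locally_convex) \<Rightarrow> 'p \<Rightarrow> 'a \<Rightarrow> 'd" where
  "calabi AP AM \<theta> chi J p \<xi> = tangent_map AM vec_atlas J (chi p) (inf_action AP AM \<theta> chi \<xi> p)"

definition a_equivariant ::
  "('p::t2_space, 'f::locally_convex) chart set \<Rightarrow> ('m::t2_space, 'e::locally_convex) chart set \<Rightarrow>
   ('a::locally_convex \<Rightarrow> 'a \<Rightarrow> 'a) \<Rightarrow> ('p \<Rightarrow> 'f \<Rightarrow> 'a) \<Rightarrow> ('p \<Rightarrow> 'm) \<Rightarrow>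
   ('d::locally_convex \<Rightarrow> 'a \<Rightarrow> real) \<Rightarrow> ('m \<Rightarrow> 'd) \<Rightarrow> ('g \<Rightarrow> 'd) \<Rightarrow> bool" where
  "a_equivariant AP AM abr \<theta> chi \<kappa>a J \<sigma> \<longleftrightarrow>
     (\<forall>p \<xi> \<eta>. \<kappa>a (calabi AP AM \<theta> chi J p \<xi>) \<eta> - \<kappa>a (calabi AP AM \<theta> chi J p \<eta>) \<xi>
        = - \<kappa>a (J (chi p)) (abr \<xi> \<eta>)) \<and>
     (\<forall>g \<xi>. \<kappa>a (\<sigma> g) \<xi> = 0)"


section \<open>Kempf--Ness functions\<close>

definition kempf_ness_function ::
  "('p::t2_space, 'f::locally_convex) chart set \<Rightarrow> ('b::t2_space, 'h::locally_convex) chart set \<Rightarrow>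
   ('p \<Rightarrow> 'b) \<Rightarrow> ('p \<Rightarrow> 'f \<Rightarrow> 'a) \<Rightarrow> ('p \<Rightarrow> 'm) \<Rightarrow> ('d \<Rightarrow> 'a \<Rightarrow> real) \<Rightarrow> ('m \<Rightarrow> 'd) \<Rightarrow>
   ('b \<Rightarrow> real) \<Rightarrow> bool" where
  "kempf_ness_function AP AB \<pi> \<theta> chi \<kappa>a J \<Psi> \<longleftrightarrow> smooth_map AB vec_atlas \<Psi> \<and>
     (\<exists>\<beta>. smooth_1form AB \<beta> \<and> (\<forall>b X Y. ext_deriv1 AB \<beta> b X Y = 0) \<and>
        (\<forall>p X. \<beta> (\<pi> p) (tangent_map AP AB \<pi> p X) = \<kappa>a (J (chi p)) (\<theta> p X)) \<and>
        (\<forall>b X. tangent_map AB vec_atlas \<Psi> b X = \<beta> b X))"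

definition critical_point ::
  "('b::t2_space, 'h::locally_convex) chart set \<Rightarrow> ('b \<Rightarrow> real) \<Rightarrow> 'b \<Rightarrow> bool" where
  "critical_point AB \<Psi> b \<longleftrightarrow> (\<forall>X. tangent_map AB vec_atlas \<Psi> b X = 0)"

definition has_second_deriv :: "(real \<Rightarrow> real) \<Rightarrow> real \<Rightarrow> real \<Rightarrow> real set \<Rightarrow> bool" where
  "has_second_deriv f D t S \<longleftrightarrow>
     (\<exists>f'. (\<forall>s\<in>S. (f has_real_derivative f' s) (at s within S)) \<and>
        (f' has_real_derivative D) (at t within S))"


section \<open>Subalgebras of the complexification\<close>

text \<open>
  The complexification of \<open>'l\<close> is \<open>'l \<times> 'l\<close>, with \<open>(x, y)\<close> standing for \<open>x + i y\<close>. The inclusion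
  \<open>\<aa> = \<gg> \<oplus> i \<mm> \<subseteq> \<gg>\<^sub>\<complex>\<close> is an embedding \<open>e\<close> with range \<open>UNIV \<times> \<mm>\<close>.
\<close>

definition complexified_bracket :: "('l \<Rightarrow> 'l \<Rightarrow> 'l) \<Rightarrow> 'l \<times> 'l \<Rightarrow> 'l \<times> 'l \<Rightarrow> 'l::locally_convex \<times> 'l" where
  "complexified_bracket br = (\<lambda>(x1, x2) (y1, y2). (br x1 y1 - br x2 y2, br x1 y2 + br x2 y1))"

definition im_part :: "('a \<Rightarrow> 'l \<times> 'l) \<Rightarrow> 'a \<Rightarrow> 'l" where
  "im_part e \<xi> = snd (e \<xi>)"

definition cplx :: "('a \<Rightarrow> 'l \<times> 'l) \<Rightarrow> 'l \<Rightarrow> 'l \<Rightarrow> 'a" where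
  "cplx e x y = inv_into UNIV e (x, y)"

definition complexified_klein_pair ::
  "('g::t2_space) monoid \<Rightarrow> ('g, 'l::locally_convex) chart set \<Rightarrow>
   ('a::locally_convex \<Rightarrow> 'a \<Rightarrow> 'a) \<Rightarrow> ('l \<Rightarrow> 'a) \<Rightarrow> ('g \<Rightarrow> 'a \<Rightarrow> 'a) \<Rightarrow>
   'l set \<Rightarrow> ('a \<Rightarrow> 'l \<times> 'l) \<Rightarrow> bool" where
  "complexified_klein_pair G AG abr \<iota> Ad \<mm> e \<longleftrightarrow> subspace \<mm> \<and>
     linear e \<and> homeomorphism UNIV (UNIV \<times> \<mm>) e (inv_into UNIV e) \<and>
     (\<forall>x. e (\<iota> x) = (x, 0)) \<and>
     (\<forall>\<xi> \<eta>. e (abr \<xi> \<eta>) = complexified_bracket (group_bracket G AG) (e \<xi>) (e \<eta>)) \<and>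
     (\<forall>g \<xi>. e (Ad g \<xi>) = map_prod (adjoint_rep G AG g) (adjoint_rep G AG g) (e \<xi>)) \<and>
     (\<forall>x. \<forall>y\<in>\<mm>. abr (\<iota> x) (cplx e 0 y) \<in> cplx e 0 ` \<mm>)"

end

theory Submission
  imports Defs
begin

text \<open>
  The Kempf--Ness function is a primitive of the form on \<open>B\<close> that pulls back to
  \<open>\<alpha>\<^sub>p(X) = \<kappa>\<^sub>\<aa>(J(\<chi>(p)), \<theta>\<^sub>p(X))\<close>, so everything is read off from \<open>\<alpha>\<close>.

  The projection of a principal bundle is a submersion and \<open>\<theta>\<^sub>p\<close> is onto \<open>\<aa>\<close>. Hence \<open>d\<Psi>\<close> vanishes
  at \<open>\<pi>(p)\<close> exactly if \<open>\<alpha>\<^sub>p = 0\<close>, i.e. if \<open>\<kappa>\<^sub>\<aa>(J(\<chi>(p)), \<xi>) = 0\<close> for all \<open>\<xi>\<close>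
  (\<open>kempf_ness_critical_point_iff\<close>).

  An integral curve \<open>\<gamma>\<close> of \<open>\<theta>\<inverse>(\<xi>)\<close> has \<open>\<theta>(\<gamma>') = \<xi>\<close>. So the first derivative of
  \<open>\<Psi> \<circ> \<pi> \<circ> \<gamma>\<close> is \<open>\<kappa>\<^sub>\<aa>(J(\<chi>(\<gamma>(t))), \<xi>)\<close>; here the second argument is constant, and as \<open>\<gamma>\<close> moves
  \<open>\<chi>(\<gamma>(t))\<close> with velocity \<open>\<xi> \<cdot> \<chi>(\<gamma>(t))\<close>, the second one is \<open>\<kappa>\<^sub>\<aa>(C\<^sub>\<gamma>\<^sub>(\<^sub>t\<^sub>)\<xi>, \<xi>)\<close>
  (\<open>kempf_ness_along_integral_curve\<close>).

  In the complexified case write \<open>\<xi> = x + iy\<close> and \<open>v = y \<cdot> \<chi>(p)\<close>. The duality turns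
  \<open>\<kappa>\<^sub>\<aa>(C\<^sub>p\<xi>, \<xi>)\<close> into \<open>-\<kappa>(C\<^sub>p\<xi>, y)\<close>, which is \<open>\<omega>(v, \<xi> \<cdot> \<chi>(p))\<close> by the momentum map
  condition, and \<open>\<xi> \<cdot> \<chi>(p) = x \<cdot> \<chi>(p) + jv\<close>. For \<open>x = 0\<close> this leaves
  \<open>\<omega>(v, jv) = |v|\<^sup>2 = |jv|\<^sup>2\<close>, whence convexity. At a critical point the term with \<open>x\<close> vanishes too:
  \<open>\<omega>(v, x \<cdot> \<chi>(p)) = \<kappa>\<^sub>\<aa>(C\<^sub>px, \<xi>)\<close>, which by \<open>\<aa>\<close>-equivariance differs from \<open>\<kappa>\<^sub>\<aa>(C\<^sub>p\<xi>, x) = 0\<close>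
  by \<open>\<kappa>\<^sub>\<aa>(J(\<chi>(p)), [x, \<xi>]) = 0\<close>.

  The analytic input is one chain rule, \<open>has_velocity_compose\<close>: a \<open>C\<^sup>1\<close> map carries velocities of
  curves to velocities. It holds over arbitrary locally convex spaces and is used
  in place of any functoriality of tangent maps: identities such as \<open>T\<pi> \<circ> Ts = id\<close> for a
  section \<open>s\<close> follow by computing the velocity of one curve in two ways.
\<close>

section \<open>Differential calculus on locally convex spaces\<close>

lemma tendsto_scaleR_locally_convex:
  fixes g :: "'i \<Rightarrow> 'a::locally_convex"
  assumes "(f \<longlongrightarrow> r) F" and "(g \<longlongrightarrow> a) F"
  shows "((\<lambda>i. f i *\<^sub>R g i) \<longlongrightarrow> r *\<^sub>R a) F"
  using filterlim_compose[OF tendsto_scaleR_Pair[of r a] filterlim_Pair[OF assms]] by simp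

lemma tendsto_line:
  fixes x v :: "'a::locally_convex"
  shows "((\<lambda>r. x + r *\<^sub>R v) \<longlongrightarrow> x) (at 0)"
proof -
  have "((\<lambda>r. r *\<^sub>R v) \<longlongrightarrow> 0 *\<^sub>R v) (at 0)"
    by (rule tendsto_scaleR_locally_convex) auto
  from tendsto_add[OF tendsto_const this] show ?thesis
    by simp
qed

lemma has_dirderiv_imp_dirderiv: "has_dirderiv f x v l \<Longrightarrow> dirderiv f x v = l"
  unfolding has_dirderiv_def dirderiv_def by (rule tendsto_Lim) simp_all

lemma dirderiv_zero_direction [simp]: "dirderiv f x 0 = 0"
  by (rule has_dirderiv_imp_dirderiv) (simp add: has_dirderiv_def)

text \<open>
  The mean value theorem for curves in a space without norm. A convex set that contains the
  difference quotients over two adjacent intervals contains the one over their union, which is a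
  convex combination of them; so a bisection argument passes from short intervals to \<open>[a, b]\<close>.
  Since \<open>V\<close> is open, it contains the quotients over all short intervals around a point as soon as it
  contains the derivative there. Working with convex sets directly replaces the usual appeal to
  continuous linear functionals.
\<close>

lemma difference_quotient_in_convex:
  fixes G :: "real \<Rightarrow> 'a::locally_convex"
  assumes "open V" and "convex V" and "a < b"
    and deriv: "\<And>t. t \<in> {a..b} \<Longrightarrow> \<exists>l\<in>V. ((\<lambda>h. (G (t + h) - G t) /\<^sub>R h) \<longlongrightarrow> l) (at 0)"
  shows "(G b - G a) /\<^sub>R (b - a) \<in> V"
proof -
  define P where "P u v \<longleftrightarrow> (u < v \<longrightarrow> (G v - G u) /\<^sub>R (v - u) \<in> V)" for u v
  have trans: "P u w" if "P u v" "P v w" "u \<le> v" "v \<le> w" for u v w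
  proof (cases "u < v \<and> v < w")
    case True
    define r where "r = (v - u) / (w - u)"
    have r: "r \<ge> 0" "1 - r \<ge> 0" "1 - r = (w - v) / (w - u)"
      using True by (simp_all add: r_def field_simps)
    have "r *\<^sub>R ((G v - G u) /\<^sub>R (v - u)) = (G v - G u) /\<^sub>R (w - u)"
      using True by (simp add: r_def field_simps)
    moreover have "(1 - r) *\<^sub>R ((G w - G v) /\<^sub>R (w - v)) = (G w - G v) /\<^sub>R (w - u)"
      unfolding r(3) using True by (simp add: field_simps)
    ultimately have "(G w - G u) /\<^sub>R (w - u) =
        r *\<^sub>R ((G v - G u) /\<^sub>R (v - u)) + (1 - r) *\<^sub>R ((G w - G v) /\<^sub>R (w - v))"
      by (simp add: scaleR_diff_right)
    moreover have "r *\<^sub>R ((G v - G u) /\<^sub>R (v - u)) + (1 - r) *\<^sub>R ((G w - G v) /\<^sub>R (w - v)) \<in> V"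
      using that True r by (intro convexD[OF \<open>convex V\<close>]) (auto simp: P_def)
    ultimately show ?thesis
      by (simp add: P_def)
  next
    case False
    then show ?thesis
      using that by (auto simp: P_def)
  qed
  have "P a b"
  proof (rule Bolzano)
    show "a \<le> b"
      using \<open>a < b\<close> by simp
    show "P u w" if "P u v" "P v w" "u \<le> v" "v \<le> w" for u v w
      using trans that by blast
    fix t assume t: "a \<le> t" "t \<le> b"
    then obtain l where "l \<in> V" "((\<lambda>h. (G (t + h) - G t) /\<^sub>R h) \<longlongrightarrow> l) (at 0)"
      using deriv[of t] by auto
    then have "\<forall>\<^sub>F h in at 0. (G (t + h) - G t) /\<^sub>R h \<in> V"
      using topological_tendstoD \<open>open V\<close> by blast
    then obtain d where "d > 0" and d: "\<And>h. h \<noteq> 0 \<Longrightarrow> \<bar>h\<bar> < d \<Longrightarrow> (G (t + h) - G t) /\<^sub>R h \<in> V"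
      unfolding eventually_at by (auto simp: dist_real_def)
    have "P u v" if "u \<le> t" "t \<le> v" "v - u < d" for u v
    proof (rule trans[OF _ _ that(1,2)])
      show "P t v"
        using d[of "v - t"] that by (auto simp: P_def)
      show "P u t"
        unfolding P_def
      proof
        assume "u < t"
        then have "(G u - G t) /\<^sub>R (u - t) \<in> V"
          using d[of "u - t"] that by auto
        moreover have "(G u - G t) /\<^sub>R (u - t) = (G t - G u) /\<^sub>R (t - u)"
          by (metis inverse_minus_eq minus_diff_eq scaleR_minus_left scaleR_minus_right)
        ultimately show "(G t - G u) /\<^sub>R (t - u) \<in> V"
          by simp
      qed
    qed
    then show "\<exists>d>0. \<forall>u v. u \<le> t \<and> t \<le> v \<and> v - u < d \<longrightarrow> P u v"
      using \<open>d > 0\<close> by blast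
  qed
  then show ?thesis
    using \<open>a < b\<close> by (simp add: P_def)
qed

text \<open>
  The class \<open>C\<^sup>1\<close> in the sense of Michal--Bastiani. Unlike full smoothness, it passes to partial maps
  without an induction over iterated derivatives, and it suffices for the chain rule.
\<close>

definition C1_on :: "'e::locally_convex set \<Rightarrow> ('e \<Rightarrow> 'f::locally_convex) \<Rightarrow> bool" where
  "C1_on U f \<longleftrightarrow> (\<forall>x\<in>U. \<forall>v. has_dirderiv f x v (dirderiv f x v)) \<and>
     continuous_on (U \<times> UNIV) (\<lambda>(x, v). dirderiv f x v)"

lemma smooth_on_imp_C1_on:
  assumes "smooth_on U f"
  shows "C1_on U f"
  unfolding C1_on_def
proof (intro conjI ballI allI)
  fix x v assume "x \<in> U"
  then obtain l where "has_dirderiv (dirderivs 0 f (\<lambda>_. v)) x v l"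
    using assms unfolding smooth_on_def by blast
  then show "has_dirderiv f x v (dirderiv f x v)"
    using has_dirderiv_imp_dirderiv by (metis dirderivs.simps(1))
next
  have "continuous_on (U \<times> UNIV) (\<lambda>(x, v). dirderivs (Suc 0) f v x)"
    using assms unfolding smooth_on_def by blast
  then have "continuous_on ((\<lambda>z. (fst z, \<lambda>_::nat. snd z)) ` (U \<times> UNIV))
      (\<lambda>(x, v). dirderivs (Suc 0) f v x)"
    by (rule continuous_on_subset) auto
  moreover have "continuous_on (U \<times> UNIV) (\<lambda>z::'a \<times> 'a. (fst z, \<lambda>_::nat. snd z))"
    by (intro continuous_intros continuous_on_coordinatewise_then_product)
  ultimately have "continuous_on (U \<times> UNIV)
      ((\<lambda>(x, v). dirderivs (Suc 0) f v x) \<circ> (\<lambda>z. (fst z, \<lambda>_. snd z)))"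
    using continuous_on_compose by blast
  then show "continuous_on (U \<times> UNIV) (\<lambda>(x, v). dirderiv f x v)"
    by (simp add: comp_def case_prod_beta)
qed

text \<open>
  The directional derivative is also the limit of difference quotients along varying directions.
  This is what the chain rule needs, and the place where joint continuity of the derivative enters:
  by the mean value theorem the quotient lies in any open convex set containing the derivatives
  along the segment from \<open>x\<close> to \<open>x + h w\<close>, all of which are close to the one at \<open>(x, v)\<close>.
\<close>

lemma C1_on_difference_quotient:
  fixes F :: "'e::locally_convex \<Rightarrow> 'f::locally_convex" and h :: "'i \<Rightarrow> real"
  assumes "open U" and "x \<in> U" and C1: "C1_on U F"
    and h: "(h \<longlongrightarrow> 0) \<Phi>" "\<forall>\<^sub>F i in \<Phi>. h i \<noteq> 0" and w: "(w \<longlongrightarrow> v) \<Phi>"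
  shows "((\<lambda>i. (F (x + h i *\<^sub>R w i) - F x) /\<^sub>R h i) \<longlongrightarrow> dirderiv F x v) \<Phi>"
proof (rule topological_tendstoI)
  define D where "D = dirderiv F x v"
  fix W assume W: "open W" "dirderiv F x v \<in> W"
  have "open ((\<lambda>z. D + z) -` W)"
    by (intro open_vimage W continuous_intros)
  then obtain V where V: "open V" "convex V" "0 \<in> V" "V \<subseteq> (\<lambda>z. D + z) -` W"
    using convex_neighbourhood[of "(\<lambda>z. D + z) -` W"] W by (auto simp: D_def)
  define K where "K = (\<lambda>z. z - D) -` V"
  have "open K"
    unfolding K_def by (intro open_vimage V continuous_intros)
  have "K = (\<lambda>z. D + z) ` V"
    by (force simp: K_def)
  then have "convex K"
    using V(2) convex_translation by blast
  have "D \<in> K" "K \<subseteq> W"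
    using V(3,4) by (auto simp: K_def subset_eq)
  define T where "T = (U \<times> UNIV) \<inter> (\<lambda>(y, u). dirderiv F y u) -` K"
  have "open T"
    unfolding T_def using C1 \<open>open K\<close> \<open>open U\<close>
    by (intro continuous_open_preimage) (auto simp: C1_on_def open_Times)
  moreover have "(x, v) \<in> T"
    using \<open>D \<in> K\<close> \<open>x \<in> U\<close> by (simp add: T_def D_def)
  ultimately obtain A B where AB: "open A" "open B" "(x, v) \<in> A \<times> B" "A \<times> B \<subseteq> T"
    by (rule open_prod_elim)
  have "open ((\<lambda>z. x + z) -` A)"
    by (intro open_vimage AB continuous_intros)
  then obtain N where N: "open N" "convex N" "0 \<in> N" "N \<subseteq> (\<lambda>z. x + z) -` A"
    using convex_neighbourhood[of "(\<lambda>z. x + z) -` A"] AB(3) by auto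
  have "((\<lambda>i. h i *\<^sub>R w i) \<longlongrightarrow> 0) \<Phi>"
    using tendsto_scaleR_locally_convex[OF h(1) w] by simp
  then have "\<forall>\<^sub>F i in \<Phi>. h i *\<^sub>R w i \<in> N"
    using N topological_tendstoD by blast
  moreover have "\<forall>\<^sub>F i in \<Phi>. w i \<in> B"
    using AB(2,3) topological_tendstoD[OF w] by blast
  ultimately show "\<forall>\<^sub>F i in \<Phi>. (F (x + h i *\<^sub>R w i) - F x) /\<^sub>R h i \<in> W"
    using h(2)
  proof eventually_elim
    case (elim i)
    \<comment> \<open>Dividing by \<open>h i\<close> gives \<open>G\<close> the derivative \<open>dirderiv F y (w i)\<close> at \<open>s\<close>, with the unscaled direction.\<close>
    define G where "G s = F (x + s *\<^sub>R h i *\<^sub>R w i) /\<^sub>R h i" for s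
    have "(G 1 - G 0) /\<^sub>R (1 - 0) \<in> K"
    proof (rule difference_quotient_in_convex[OF \<open>open K\<close> \<open>convex K\<close>])
      fix s :: real assume s: "s \<in> {0..1}"
      define y where "y = x + s *\<^sub>R h i *\<^sub>R w i"
      have "s *\<^sub>R h i *\<^sub>R w i + (1 - s) *\<^sub>R 0 \<in> N"
        using s elim N by (intro convexD) auto
      then have "(y, w i) \<in> T"
        using N(4) AB(4) elim by (auto simp: y_def)
      then have y: "y \<in> U" "dirderiv F y (w i) \<in> K"
        by (auto simp: T_def)
      have "filterlim (\<lambda>\<tau>. \<tau> * h i) (at 0) (at 0)"
        unfolding filterlim_at using elim
        by (auto simp: eventually_at_filter intro!: tendsto_eq_intros)
      moreover have "((\<lambda>\<tau>. (F (y + \<tau> *\<^sub>R w i) - F y) /\<^sub>R \<tau>) \<longlongrightarrow> dirderiv F y (w i)) (at 0)"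
        using C1 y(1) unfolding C1_on_def has_dirderiv_def by blast
      ultimately have "((\<lambda>\<tau>. (F (y + (\<tau> * h i) *\<^sub>R w i) - F y) /\<^sub>R (\<tau> * h i)) \<longlongrightarrow>
          dirderiv F y (w i)) (at 0)"
        by (rule filterlim_compose[rotated])
      then have "((\<lambda>\<tau>. (G (s + \<tau>) - G s) /\<^sub>R \<tau>) \<longlongrightarrow> dirderiv F y (w i)) (at 0)"
        by (simp add: G_def y_def algebra_simps)
      with y(2) show "\<exists>l\<in>K. ((\<lambda>\<tau>. (G (s + \<tau>) - G s) /\<^sub>R \<tau>) \<longlongrightarrow> l) (at 0)"
        by blast
    qed simp
    then show ?case
      using \<open>K \<subseteq> W\<close> by (auto simp: G_def scaleR_diff_right)
  qed
qed


section \<open>Velocities of curves in manifolds\<close>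

text \<open>
  The chain rule for curves uses nothing of a manifold but its charts being homeomorphisms onto open
  sets, so that it also applies to maps into \<open>vec_atlas\<close> without proving that the identity is smooth.
\<close>

definition topological_atlas :: "('m::t2_space, 'e::locally_convex) chart set \<Rightarrow> bool" where
  "topological_atlas A \<longleftrightarrow> (\<Union>c\<in>A. fst c) = UNIV \<and>
     (\<forall>c\<in>A. open (fst c) \<and> open (chart_image c) \<and>
        homeomorphism (fst c) (chart_image c) (snd c) (chart_inv c))"

lemma manifold_imp_topological_atlas: "manifold A \<Longrightarrow> topological_atlas A"
  by (simp add: manifold_def topological_atlas_def)

lemma topological_atlas_vec_atlas: "topological_atlas vec_atlas"
  by (auto simp: topological_atlas_def vec_atlas_def chart_image_def chart_inv_def
      inv_into_def homeomorphism_def)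

lemma chart_at_vec_atlas: "chart_at vec_atlas p = (UNIV, \<lambda>x. x)"
  unfolding chart_at_def vec_atlas_def by (rule some_equality) auto

lemma chart_at:
  assumes "topological_atlas A"
  shows "chart_at A p \<in> A" and "p \<in> fst (chart_at A p)"
proof -
  have "\<exists>c. c \<in> A \<and> p \<in> fst c"
    using assms unfolding topological_atlas_def by blast
  then have "chart_at A p \<in> A \<and> p \<in> fst (chart_at A p)"
    unfolding chart_at_def by (rule someI_ex)
  then show "chart_at A p \<in> A" "p \<in> fst (chart_at A p)"
    by auto
qed

lemma topological_atlas_chart:
  assumes "topological_atlas A" and "c \<in> A"
  shows "open (fst c)" and "open (chart_image c)"
    and "homeomorphism (fst c) (chart_image c) (snd c) (chart_inv c)"
  using assms by (auto simp: topological_atlas_def)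

lemma chart_inv_chart:
  assumes "topological_atlas A" and "c \<in> A" and "p \<in> fst c"
  shows "chart_inv c (snd c p) = p"
  using homeomorphism_apply1[OF topological_atlas_chart(3)[OF assms(1,2)] assms(3)] .

definition C1_map_on ::
  "('m::t2_space, 'e::locally_convex) chart set \<Rightarrow> ('n::t2_space, 'f::locally_convex) chart set \<Rightarrow>
   'm set \<Rightarrow> ('m \<Rightarrow> 'n) \<Rightarrow> bool" where
  "C1_map_on A B S f \<longleftrightarrow> continuous_on S f \<and>
     (\<forall>c\<in>A. \<forall>d\<in>B. C1_on (snd c ` (fst c \<inter> S \<inter> f -` fst d)) (snd d \<circ> f \<circ> chart_inv c))"

lemma smooth_map_on_imp_C1_map_on: "smooth_map_on A B S f \<Longrightarrow> C1_map_on A B S f"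
  by (simp add: smooth_map_on_def C1_map_on_def smooth_on_imp_C1_on)

lemma open_chart_domain:
  assumes A: "topological_atlas A" and "c \<in> A" and "open S" and "continuous_on S f" and "open T"
  shows "open (snd c ` (fst c \<inter> S \<inter> f -` T))"
proof -
  note c = topological_atlas_chart[OF A \<open>c \<in> A\<close>]
  have "open (S \<inter> f -` T)"
    using assms by (intro continuous_open_preimage)
  then have "open (fst c \<inter> S \<inter> f -` T)"
    using c(1) by (simp add: Int_assoc open_Int)
  then have "openin (top_of_set (fst c)) (fst c \<inter> S \<inter> f -` T)"
    using c(1) by (simp add: openin_open_eq) blast
  then have "openin (top_of_set (chart_image c)) (snd c ` (fst c \<inter> S \<inter> f -` T))"
    by (rule homeomorphism_imp_open_map[OF c(3)])
  then show ?thesis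
    using c(2) openin_open_trans by blast
qed

text \<open>
  In the charts chosen at \<open>\<gamma>(t)\<close> and \<open>f(\<gamma>(t))\<close> the curve is \<open>x + h w(h)\<close> with \<open>h = s - t\<close> and a
  direction \<open>w(h)\<close> converging to the velocity, so the difference quotients along varying
  directions apply.
\<close>

lemma has_velocity_compose:
  fixes \<gamma> :: "real \<Rightarrow> 'm::t2_space"
    and A :: "('m, 'e::locally_convex) chart set"
    and B :: "('n::t2_space, 'f::locally_convex) chart set"
  assumes A: "topological_atlas A" and B: "topological_atlas B"
    and f: "C1_map_on A B U f" and "open U" and "\<gamma> t \<in> U"
    and cont: "continuous (at t within S) \<gamma>" and vel: "has_velocity A \<gamma> t S v"
  shows "has_velocity B (\<lambda>s. f (\<gamma> s)) t S (tangent_map A B f (\<gamma> t) v)"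
proof -
  define c where "c = chart_at A (\<gamma> t)"
  define d where "d = chart_at B (f (\<gamma> t))"
  define F where "F = snd d \<circ> f \<circ> chart_inv c"
  define V where "V = snd c ` (fst c \<inter> U \<inter> f -` fst d)"
  have c: "c \<in> A" "\<gamma> t \<in> fst c" and d: "d \<in> B" "f (\<gamma> t) \<in> fst d"
    using chart_at[OF A] chart_at[OF B] by (simp_all add: c_def d_def)
  have F: "F (snd c q) = snd d (f q)" if "q \<in> fst c" for q
    using chart_inv_chart[OF A c(1) that] by (simp add: F_def)
  have "open V"
    unfolding V_def using A c(1) \<open>open U\<close> f topological_atlas_chart(1)[OF B d(1)]
    by (intro open_chart_domain) (auto simp: C1_map_on_def)
  moreover have "snd c (\<gamma> t) \<in> V"
    using c d \<open>\<gamma> t \<in> U\<close> by (auto simp: V_def)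
  moreover have "C1_on V F"
    using f c d by (simp add: C1_map_on_def V_def F_def)
  moreover have "((\<lambda>s. s - t) \<longlongrightarrow> 0) (at t within S)"
    by (auto intro!: tendsto_eq_intros)
  moreover have ne: "\<forall>\<^sub>F s in at t within S. s - t \<noteq> 0"
    by (auto simp: eventually_at_filter)
  moreover have "((\<lambda>s. (snd c (\<gamma> s) - snd c (\<gamma> t)) /\<^sub>R (s - t)) \<longlongrightarrow> v) (at t within S)"
    using vel by (simp add: has_velocity_def Let_def c_def)
  ultimately have "((\<lambda>s. (F (snd c (\<gamma> t) + (s - t) *\<^sub>R ((snd c (\<gamma> s) - snd c (\<gamma> t)) /\<^sub>R (s - t))) -
      F (snd c (\<gamma> t))) /\<^sub>R (s - t)) \<longlongrightarrow> dirderiv F (snd c (\<gamma> t)) v) (at t within S)"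
    by (rule C1_on_difference_quotient)
  moreover have "\<forall>\<^sub>F s in at t within S.
      (F (snd c (\<gamma> t) + (s - t) *\<^sub>R ((snd c (\<gamma> s) - snd c (\<gamma> t)) /\<^sub>R (s - t))) -
        F (snd c (\<gamma> t))) /\<^sub>R (s - t) =
      (snd d (f (\<gamma> s)) - snd d (f (\<gamma> t))) /\<^sub>R (s - t)"
  proof -
    have "\<forall>\<^sub>F s in at t within S. \<gamma> s \<in> fst c"
      using cont[unfolded continuous_within] topological_atlas_chart(1)[OF A c(1)] c(2)
      by (rule topological_tendstoD)
    then show ?thesis
      using ne by eventually_elim (simp add: F c(2))
  qed
  ultimately have "((\<lambda>s. (snd d (f (\<gamma> s)) - snd d (f (\<gamma> t))) /\<^sub>R (s - t)) \<longlongrightarrow>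
      dirderiv F (snd c (\<gamma> t)) v) (at t within S)"
    by (rule Lim_transform_eventually)
  then show ?thesis
    by (simp add: has_velocity_def Let_def tangent_map_def F_def flip: c_def d_def)
qed

lemma has_velocity_unique:
  assumes "has_velocity A \<gamma> t S v" and "has_velocity A \<gamma> t S w" and "at t within S \<noteq> bot"
  shows "v = w"
  using assms tendsto_unique unfolding has_velocity_def Let_def by blast

lemma has_velocity_transform:
  assumes "has_velocity A \<gamma> t S v" and "\<gamma> t = \<gamma>' t" and "\<forall>\<^sub>F s in at t within S. \<gamma> s = \<gamma>' s"
  shows "has_velocity A \<gamma>' t S v"
  unfolding has_velocity_def Let_def
proof (rule Lim_transform_eventually)
  show "((\<lambda>s. (snd (chart_at A (\<gamma>' t)) (\<gamma> s) - snd (chart_at A (\<gamma>' t)) (\<gamma>' t)) /\<^sub>R (s - t)) \<longlongrightarrow> v)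
      (at t within S)"
    using assms(1,2) by (simp add: has_velocity_def Let_def)
qed (use assms(3) in eventually_elim, simp)

lemma has_velocity_real:
  "has_velocity vec_atlas f t S v \<longleftrightarrow> (f has_real_derivative v) (at t within S)"
  by (simp add: has_velocity_def chart_at_vec_atlas has_field_derivative_iff divide_inverse mult.commute)

lemma exists_curve_with_velocity:
  assumes A: "topological_atlas A"
  obtains \<gamma> where "\<gamma> 0 = p" and "continuous (at 0) \<gamma>" and "has_velocity A \<gamma> 0 UNIV v"
proof -
  define c where "c = chart_at A p"
  define \<gamma> where "\<gamma> r = chart_inv c (snd c p + r *\<^sub>R v)" for r :: real
  have c: "c \<in> A" "p \<in> fst c"
    using chart_at[OF A] by (simp_all add: c_def)
  note hc = topological_atlas_chart[OF A c(1)]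
  have 0: "\<gamma> 0 = p"
    using chart_inv_chart[OF A c] by (simp add: \<gamma>_def)
  have im: "snd c p \<in> chart_image c"
    using c by (simp add: chart_image_def)
  have line: "((\<lambda>r. snd c p + r *\<^sub>R v) \<longlongrightarrow> snd c p) (at 0)"
    by (rule tendsto_line)
  have "isCont (chart_inv c) (snd c p)"
    using homeomorphism_cont2[OF hc(3)] im unfolding continuous_on_eq_continuous_at[OF hc(2)] ..
  from isCont_tendsto_compose[OF this line] have "(\<gamma> \<longlongrightarrow> p) (at 0)"
    by (simp add: \<gamma>_def[abs_def] chart_inv_chart[OF A c])
  then have cont: "continuous (at 0) \<gamma>"
    by (simp add: continuous_within 0)
  have "\<forall>\<^sub>F r in at 0. snd c p + r *\<^sub>R v \<in> chart_image c"
    using topological_tendstoD[OF line hc(2) im] .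
  moreover have "\<forall>\<^sub>F r in at (0::real). r \<noteq> 0"
    by (auto simp: eventually_at_filter)
  ultimately have "\<forall>\<^sub>F r in at 0. v = (snd c (\<gamma> r) - snd c p) /\<^sub>R (r - 0)"
    by eventually_elim (simp add: \<gamma>_def homeomorphism_apply2[OF hc(3)])
  with tendsto_const have "((\<lambda>r. (snd c (\<gamma> r) - snd c p) /\<^sub>R (r - 0)) \<longlongrightarrow> v) (at 0)"
    by (rule Lim_transform_eventually)
  then have "has_velocity A \<gamma> 0 UNIV v"
    by (simp add: has_velocity_def 0 flip: c_def)
  with 0 cont show thesis
    using that by blast
qed

text \<open>
  The chart that \<open>chart_at\<close> selects for a product need not be a product of selected charts, so a
  velocity in a product does not split into components. The regularity of a partial map is instead
  obtained in the product of a chart with the chart at the fixed point.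
\<close>

lemma C1_map_on_partial:
  fixes f :: "'m::t2_space \<times> 'n::t2_space \<Rightarrow> 'k::t2_space"
    and A :: "('m, 'e::locally_convex) chart set" and A' :: "('n, 'f::locally_convex) chart set"
    and B :: "('k, 'h::locally_convex) chart set"
  assumes A: "topological_atlas A" and A': "topological_atlas A'" and B: "topological_atlas B"
    and f: "C1_map_on (prod_atlas A A') B (U \<times> V) f" and "open U" and "q \<in> V"
  shows "C1_map_on A B U (\<lambda>x. f (x, q))"
  unfolding C1_map_on_def
proof (intro conjI ballI)
  have "continuous_on (U \<times> V) f"
    using f by (simp add: C1_map_on_def)
  then show cont: "continuous_on U (\<lambda>x. f (x, q))"
  proof (rule continuous_on_compose2)
    show "continuous_on U (\<lambda>x. (x, q))"
      by (intro continuous_on_Pair continuous_on_id continuous_on_const)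
  qed (use \<open>q \<in> V\<close> in auto)
  fix c d assume c: "c \<in> A" and d: "d \<in> B"
  define c' where "c' = chart_at A' q"
  have c': "c' \<in> A'" "q \<in> fst c'"
    using chart_at[OF A'] by (simp_all add: c'_def)
  define C where "C = (fst c \<times> fst c', map_prod (snd c) (snd c'))"
  define F where "F = snd d \<circ> f \<circ> chart_inv C"
  define g where "g = snd d \<circ> (\<lambda>x. f (x, q)) \<circ> chart_inv c"
  define S where "S = snd c ` (fst c \<inter> U \<inter> (\<lambda>x. f (x, q)) -` fst d)"
  define T where "T = snd C ` (fst C \<inter> (U \<times> V) \<inter> f -` fst d)"
  have "C \<in> prod_atlas A A'"
    unfolding prod_atlas_def C_def using c c' by blast
  then have F: "C1_on T F"
    using f d by (simp add: C1_map_on_def F_def T_def)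
  have ST: "(y, snd c' q) \<in> T" if "y \<in> S" for y
    using that c' \<open>q \<in> V\<close> by (force simp: S_def T_def C_def)
  have "open S"
    unfolding S_def using A c \<open>open U\<close> cont topological_atlas_chart(1)[OF B d]
    by (rule open_chart_domain)
  have inj: "inj_on (snd c) (fst c)" "inj_on (snd c') (fst c')"
    using chart_inv_chart[OF A c] chart_inv_chart[OF A' c'(1)] by (auto intro: inj_on_inverseI)
  have eq: "g y = F (y, snd c' q)" if "y \<in> S" for y
  proof -
    obtain x where x: "x \<in> fst c" "y = snd c x"
      using \<open>y \<in> S\<close> by (auto simp: S_def)
    have "inj_on (snd C) (fst C)"
      using map_prod_inj_on[OF inj] by (simp add: C_def)
    then have "chart_inv C (snd C (x, q)) = (x, q)"
      unfolding chart_inv_def using x c' by (intro inv_into_f_f) (auto simp: C_def)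
    then have "chart_inv C (y, snd c' q) = (x, q)"
      by (simp add: C_def x)
    then show ?thesis
      using chart_inv_chart[OF A c x(1)] by (simp add: F_def g_def x)
  qed
  have deriv: "has_dirderiv g y v (dirderiv F (y, snd c' q) (v, 0))" if "y \<in> S" for y v
    unfolding has_dirderiv_def
  proof (rule Lim_transform_eventually)
    show "((\<lambda>r. (F ((y, snd c' q) + r *\<^sub>R (v, 0)) - F (y, snd c' q)) /\<^sub>R r) \<longlongrightarrow>
        dirderiv F (y, snd c' q) (v, 0)) (at 0)"
      using F ST[OF that] unfolding C1_on_def has_dirderiv_def by blast
    have "((\<lambda>r. y + r *\<^sub>R v) \<longlongrightarrow> y) (at 0)"
      by (rule tendsto_line)
    then have "\<forall>\<^sub>F r in at 0. y + r *\<^sub>R v \<in> S"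
      using \<open>open S\<close> \<open>y \<in> S\<close> topological_tendstoD by blast
    then show "\<forall>\<^sub>F r in at 0. (F ((y, snd c' q) + r *\<^sub>R (v, 0)) - F (y, snd c' q)) /\<^sub>R r =
        (g (y + r *\<^sub>R v) - g y) /\<^sub>R r"
      by eventually_elim (simp add: eq that)
  qed
  have "C1_on S g"
    unfolding C1_on_def
  proof (intro conjI ballI allI)
    show "has_dirderiv g y v (dirderiv g y v)" if "y \<in> S" for y v
      using deriv[OF that] has_dirderiv_imp_dirderiv by metis
    have "continuous_on (T \<times> UNIV) (\<lambda>(x, v). dirderiv F x v)"
      using F by (simp add: C1_on_def)
    then have "continuous_on (S \<times> UNIV) (\<lambda>z. (\<lambda>(x, v). dirderiv F x v) ((fst z, snd c' q), (snd z, 0)))"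
    proof (rule continuous_on_compose2)
      show "continuous_on (S \<times> UNIV) (\<lambda>z::'e \<times> 'e. ((fst z, snd c' q), (snd z, 0::'f)))"
        by (intro continuous_on_Pair continuous_on_fst continuous_on_snd continuous_on_id
            continuous_on_const)
    qed (use ST in auto)
    then show "continuous_on (S \<times> UNIV) (\<lambda>(y, v). dirderiv g y v)"
      by (rule continuous_on_eq) (auto simp: has_dirderiv_imp_dirderiv[OF deriv])
  qed
  then show "C1_on (snd c ` (fst c \<inter> U \<inter> (\<lambda>x. f (x, q)) -` fst d)) (snd d \<circ> (\<lambda>x. f (x, q)) \<circ> chart_inv c)"
    by (simp add: S_def g_def)
qed


lemma continuous_C1_map_compose:
  assumes "C1_map_on A B U f" and "open U" and "\<gamma> t \<in> U" and "continuous (at t within S) \<gamma>"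
  shows "continuous (at t within S) (\<lambda>s. f (\<gamma> s))"
proof -
  have "isCont f (\<gamma> t)"
    using assms(1-3) continuous_on_eq_continuous_at by (auto simp: C1_map_on_def)
  then show ?thesis
    using assms(4) isCont_tendsto_compose unfolding continuous_within by blast
qed

lemma has_velocity_continuous_linear:
  assumes L: "continuous_linear L" and g: "has_velocity vec_atlas g t S v"
  shows "has_velocity vec_atlas (\<lambda>s. L (g s)) t S (L v)"
proof -
  have "isCont L v"
    using L continuous_on_eq_continuous_at[OF open_UNIV] by (auto simp: continuous_linear_def)
  moreover have "((\<lambda>s. (g s - g t) /\<^sub>R (s - t)) \<longlongrightarrow> v) (at t within S)"
    using g by (simp add: has_velocity_def chart_at_vec_atlas)
  ultimately have "((\<lambda>s. L ((g s - g t) /\<^sub>R (s - t))) \<longlongrightarrow> L v) (at t within S)"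
    by (rule isCont_tendsto_compose)
  moreover have "linear L"
    using L by (simp add: continuous_linear_def)
  ultimately show ?thesis
    by (simp add: has_velocity_def chart_at_vec_atlas linear_diff linear_scale)
qed


section \<open>Principal bundles and infinitesimal actions\<close>

lemma principal_bundle_atlases:
  assumes "principal_bundle G AG AP AB act \<pi>"
  shows "topological_atlas AG" and "topological_atlas AP" and "topological_atlas AB"
    and "C1_map_on AP AB UNIV \<pi>"
proof -
  have "manifold AG" "manifold AP" "manifold AB" "smooth_map AP AB \<pi>"
    using assms by (simp_all only: principal_bundle_def lie_group_def)
  then show "topological_atlas AG" "topological_atlas AP" "topological_atlas AB"
    "C1_map_on AP AB UNIV \<pi>"
    by (simp_all add: manifold_imp_topological_atlas smooth_map_on_imp_C1_map_on)
qed

lemma principal_bundle_trivialisation: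
  assumes "principal_bundle G AG AP AB act \<pi>"
  obtains U \<tau> where "open U" and "b \<in> U"
    and "bij_betw (\<lambda>p. (\<pi> p, \<tau> p)) (\<pi> -` U) (U \<times> UNIV)"
    and "smooth_map_on (prod_atlas AB AG) AP (U \<times> UNIV) (inv_into (\<pi> -` U) (\<lambda>p. (\<pi> p, \<tau> p)))"
proof -
  have "\<forall>b. \<exists>U \<tau>. open U \<and> b \<in> U \<and> smooth_map_on AP AG (\<pi> -` U) \<tau> \<and>
      (\<forall>p\<in>\<pi> -` U. \<forall>g. \<tau> (act g p) = g \<otimes>\<^bsub>G\<^esub> \<tau> p) \<and>
      bij_betw (\<lambda>p. (\<pi> p, \<tau> p)) (\<pi> -` U) (U \<times> UNIV) \<and>
      smooth_map_on (prod_atlas AB AG) AP (U \<times> UNIV) (inv_into (\<pi> -` U) (\<lambda>p. (\<pi> p, \<tau> p)))"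
    using assms unfolding principal_bundle_def by (elim conjE)
  then show thesis
    using that by (elim allE[of _ b] exE conjE)
qed

lemma principal_bundle_projection_surj:
  assumes "principal_bundle G AG AP AB act \<pi>"
  obtains p where "\<pi> p = b"
proof -
  obtain U \<tau> where "b \<in> U" and "bij_betw (\<lambda>p. (\<pi> p, \<tau> p)) (\<pi> -` U) (U \<times> (UNIV :: 'a set))"
    using principal_bundle_trivialisation[OF assms] .
  then have "(b, undefined) \<in> (\<lambda>p. (\<pi> p, \<tau> p)) ` (\<pi> -` U)"
    by (simp add: bij_betw_def)
  then show thesis
    using that by blast
qed

text \<open>
  Through \<open>p\<close> there is a local section, constant in a trivialisation. The image under it of a curve
  in the base with velocity \<open>X\<close> has a velocity that \<open>T\<pi>\<close> maps back to \<open>X\<close>.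
\<close>

lemma principal_bundle_projection_submersion:
  assumes pb: "principal_bundle G AG AP AB act \<pi>"
  obtains Y where "tangent_map AP AB \<pi> p Y = X"
proof -
  note AG = principal_bundle_atlases(1)[OF pb] and AP = principal_bundle_atlases(2)[OF pb]
    and AB = principal_bundle_atlases(3)[OF pb] and \<pi> = principal_bundle_atlases(4)[OF pb]
  obtain U \<tau> where U: "open U" "\<pi> p \<in> U"
    and bij: "bij_betw (\<lambda>p. (\<pi> p, \<tau> p)) (\<pi> -` U) (U \<times> (UNIV :: 'a set))"
    and inv: "smooth_map_on (prod_atlas AB AG) AP (U \<times> UNIV) (inv_into (\<pi> -` U) (\<lambda>p. (\<pi> p, \<tau> p)))"
    using principal_bundle_trivialisation[OF pb] .
  define s where "s b = inv_into (\<pi> -` U) (\<lambda>p. (\<pi> p, \<tau> p)) (b, \<tau> p)" for b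
  have s: "C1_map_on AB AP U s"
    unfolding s_def[abs_def]
    by (rule C1_map_on_partial[OF AB AG AP smooth_map_on_imp_C1_map_on[OF inv] U(1) UNIV_I])
  have sp: "s (\<pi> p) = p"
    unfolding s_def using inv_into_f_f[OF bij_betw_imp_inj_on[OF bij], of p] U(2) by simp
  have \<pi>s: "\<pi> (s b) = b" if "b \<in> U" for b
  proof -
    have "(b, \<tau> p) \<in> (\<lambda>p. (\<pi> p, \<tau> p)) ` (\<pi> -` U)"
      using bij_betw_imp_surj_on[OF bij] that by simp
    from f_inv_into_f[OF this] show ?thesis
      by (simp add: s_def)
  qed
  obtain \<gamma> where \<gamma>: "\<gamma> 0 = \<pi> p" "continuous (at 0) \<gamma>" "has_velocity AB \<gamma> 0 UNIV X"
    using exists_curve_with_velocity[OF AB] .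
  have \<gamma>U: "\<gamma> 0 \<in> U"
    using U \<gamma> by simp
  have "has_velocity AP (\<lambda>r. s (\<gamma> r)) 0 UNIV (tangent_map AB AP s (\<gamma> 0) X)"
    by (rule has_velocity_compose[OF AB AP s U(1) \<gamma>U \<gamma>(2,3)])
  then have "has_velocity AB (\<lambda>r. \<pi> (s (\<gamma> r))) 0 UNIV
      (tangent_map AP AB \<pi> (s (\<gamma> 0)) (tangent_map AB AP s (\<gamma> 0) X))"
    by (rule has_velocity_compose[OF AP AB \<pi> open_UNIV UNIV_I
          continuous_C1_map_compose[OF s U(1) \<gamma>U \<gamma>(2)]])
  then have "has_velocity AB \<gamma> 0 UNIV
      (tangent_map AP AB \<pi> (s (\<gamma> 0)) (tangent_map AB AP s (\<gamma> 0) X))"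
  proof (rule has_velocity_transform)
    show "\<pi> (s (\<gamma> 0)) = \<gamma> 0"
      using \<pi>s \<gamma>U by blast
    have "\<forall>\<^sub>F r in at 0. \<gamma> r \<in> U"
      using topological_tendstoD[OF \<gamma>(2)[unfolded continuous_within] U(1) \<gamma>U] .
    then show "\<forall>\<^sub>F r in at 0. \<pi> (s (\<gamma> r)) = \<gamma> r"
      by eventually_elim (rule \<pi>s)
  qed
  then have "tangent_map AP AB \<pi> (s (\<gamma> 0)) (tangent_map AB AP s (\<gamma> 0) X) = X"
    using \<gamma>(3) by (rule has_velocity_unique) simp
  then show thesis
    using that by (simp add: \<gamma>(1) sp)
qed

lemma smooth_action_orbit_map_C1:
  assumes "lie_group G AG" and "manifold AM" and "smooth_action G AG AM act"
  shows "C1_map_on AG AM UNIV (\<lambda>g. act g q)"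
proof -
  have "C1_map_on (prod_atlas AG AM) AM (UNIV \<times> UNIV) (\<lambda>(g, m). act g m)"
    using assms(3) by (intro smooth_map_on_imp_C1_map_on) (simp add: smooth_action_def)
  from C1_map_on_partial[OF _ _ _ this open_UNIV UNIV_I, of q] assms(1,2) show ?thesis
    by (simp add: lie_group_def manifold_imp_topological_atlas)
qed

text \<open>
  An equivariant map relates fundamental fields: for a curve \<open>\<gamma>\<close> through \<open>\<one>\<close> with velocity \<open>x\<close>, the
  two sides are the velocities of \<open>\<chi>(\<gamma>(r) \<cdot> p)\<close> and of \<open>\<gamma>(r) \<cdot> \<chi>(p)\<close>.
\<close>

lemma tangent_map_fundamental_field:
  assumes G: "lie_group G AG"
    and AP: "manifold AP" and actP: "smooth_action G AG AP actP"
    and AM: "manifold AM" and actM: "smooth_action G AG AM actM"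
    and chi: "smooth_map AP AM chi" and equiv: "\<And>g p. chi (actP g p) = actM g (chi p)"
  shows "tangent_map AP AM chi p (fundamental_field G AG AP actP x p) =
    fundamental_field G AG AM actM x (chi p)"
proof -
  have AG: "topological_atlas AG" "topological_atlas AP" "topological_atlas AM"
    using G AP AM by (simp_all add: lie_group_def manifold_imp_topological_atlas)
  have "actP \<one>\<^bsub>G\<^esub> p = p"
    using actP by (simp add: smooth_action_def)
  obtain \<gamma> where \<gamma>: "\<gamma> 0 = \<one>\<^bsub>G\<^esub>" "continuous (at 0) \<gamma>" "has_velocity AG \<gamma> 0 UNIV x"
    using exists_curve_with_velocity[OF AG(1)] .
  note orbP = smooth_action_orbit_map_C1[OF G AP actP, of p]
  have "has_velocity AP (\<lambda>r. actP (\<gamma> r) p) 0 UNIV (tangent_map AG AP (\<lambda>g. actP g p) (\<gamma> 0) x)"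
    by (rule has_velocity_compose[OF AG(1,2) orbP open_UNIV UNIV_I \<gamma>(2,3)])
  then have "has_velocity AM (\<lambda>r. chi (actP (\<gamma> r) p)) 0 UNIV
      (tangent_map AP AM chi (actP (\<gamma> 0) p) (tangent_map AG AP (\<lambda>g. actP g p) (\<gamma> 0) x))"
    by (rule has_velocity_compose[OF AG(2,3) smooth_map_on_imp_C1_map_on[OF chi] open_UNIV UNIV_I
          continuous_C1_map_compose[OF orbP open_UNIV UNIV_I \<gamma>(2)]])
  moreover have "has_velocity AM (\<lambda>r. actM (\<gamma> r) (chi p)) 0 UNIV
      (tangent_map AG AM (\<lambda>g. actM g (chi p)) (\<gamma> 0) x)"
    by (rule has_velocity_compose[OF AG(1,3) smooth_action_orbit_map_C1[OF G AM actM]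
          open_UNIV UNIV_I \<gamma>(2,3)])
  ultimately show ?thesis
    unfolding fundamental_field_def equiv \<gamma>(1) \<open>actP \<one>\<^bsub>G\<^esub> p = p\<close>
    by (rule has_velocity_unique) simp
qed


section \<open>Kempf--Ness functions along integral curves\<close>

lemma cartan_field_theta:
  assumes "cartan_geometry G AG AP AB \<iota> Ad actP \<pi> \<theta>"
  shows "\<theta> p (cartan_field \<theta> \<xi> p) = \<xi>" and "cartan_field \<theta> (\<theta> p X) p = X"
proof -
  have "homeomorphism UNIV UNIV (\<theta> p) (\<lambda>\<xi>. cartan_field \<theta> \<xi> p)"
    using assms by (simp add: cartan_geometry_def)
  from homeomorphism_apply1[OF this] homeomorphism_apply2[OF this]
  show "\<theta> p (cartan_field \<theta> \<xi> p) = \<xi>" "cartan_field \<theta> (\<theta> p X) p = X"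
    by simp_all
qed

lemma kempf_ness_derivative:
  assumes "kempf_ness_function AP AB \<pi> \<theta> chi \<kappa>a J \<Psi>"
  shows "tangent_map AB vec_atlas \<Psi> (\<pi> p) (tangent_map AP AB \<pi> p X) = \<kappa>a (J (chi p)) (\<theta> p X)"
  using assms unfolding kempf_ness_function_def by auto

text \<open>
  Evaluating \<open>d\<Psi>\<close> at \<open>T\<^sub>p\<pi>(X)\<close> tests all tangent vectors of \<open>B\<close> at \<open>\<pi>(p)\<close>, as \<open>T\<^sub>p\<pi>\<close> is onto, and
  evaluating \<open>\<kappa>\<^sub>\<aa>(J(\<chi>(p)), \<cdot>)\<close> at \<open>\<theta>\<^sub>p(X)\<close> tests all of \<open>\<aa>\<close>, as \<open>\<theta>\<^sub>p\<close> is onto.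
\<close>

lemma kempf_ness_critical_point_iff:
  assumes geom: "cartan_geometry G AG AP AB \<iota> Ad actP \<pi> \<theta>"
    and \<Psi>: "kempf_ness_function AP AB \<pi> \<theta> chi \<kappa>a J \<Psi>"
  shows "critical_point AB \<Psi> (\<pi> p) \<longleftrightarrow> (\<forall>\<xi>. \<kappa>a (J (chi p)) \<xi> = 0)"
proof
  assume "critical_point AB \<Psi> (\<pi> p)"
  then show "\<forall>\<xi>. \<kappa>a (J (chi p)) \<xi> = 0"
    using kempf_ness_derivative[OF \<Psi>] cartan_field_theta(1)[OF geom]
    unfolding critical_point_def by metis
next
  assume "\<forall>\<xi>. \<kappa>a (J (chi p)) \<xi> = 0"
  moreover have "principal_bundle G AG AP AB actP \<pi>"
    using geom by (simp add: cartan_geometry_def)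
  ultimately show "critical_point AB \<Psi> (\<pi> p)"
    using kempf_ness_derivative[OF \<Psi>] principal_bundle_projection_submersion
    unfolding critical_point_def by metis
qed

lemma kempf_ness_along_integral_curve:
  assumes geom: "cartan_geometry G AG AP AB \<iota> Ad actP \<pi> \<theta>"
    and AM: "manifold AM" and chi: "smooth_map AP AM chi" and J: "smooth_map AM vec_atlas J"
    and \<kappa>a: "continuous_bilinear \<kappa>a"
    and \<Psi>: "kempf_ness_function AP AB \<pi> \<theta> chi \<kappa>a J \<Psi>"
    and \<gamma>: "integral_curve AP (cartan_field \<theta> \<xi>) \<delta> \<gamma>" and t: "t \<in> {0..\<delta>}"
  shows "((\<lambda>t. \<Psi> (\<pi> (\<gamma> t))) has_real_derivative \<kappa>a (J (chi (\<gamma> t))) \<xi>) (at t within {0..\<delta>})"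
    and "((\<lambda>t. \<kappa>a (J (chi (\<gamma> t))) \<xi>) has_real_derivative
      \<kappa>a (calabi AP AM \<theta> chi J (\<gamma> t) \<xi>) \<xi>) (at t within {0..\<delta>})"
proof -
  have pb: "principal_bundle G AG AP AB actP \<pi>"
    using geom by (simp add: cartan_geometry_def)
  note AP = principal_bundle_atlases(2)[OF pb] and AB = principal_bundle_atlases(3)[OF pb]
    and \<pi> = principal_bundle_atlases(4)[OF pb]
  note AM = manifold_imp_topological_atlas[OF AM]
  note chi = smooth_map_on_imp_C1_map_on[OF chi]
  have \<Psi>': "C1_map_on AB vec_atlas UNIV \<Psi>"
    using \<Psi> by (intro smooth_map_on_imp_C1_map_on) (simp add: kempf_ness_function_def)
  have cont: "continuous (at t within {0..\<delta>}) \<gamma>"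
    using \<gamma> t by (simp add: integral_curve_def continuous_on_eq_continuous_within)
  have vel: "has_velocity AP \<gamma> t {0..\<delta>} (cartan_field \<theta> \<xi> (\<gamma> t))"
    using \<gamma> t by (simp add: integral_curve_def)
  have "has_velocity AB (\<lambda>t. \<pi> (\<gamma> t)) t {0..\<delta>}
      (tangent_map AP AB \<pi> (\<gamma> t) (cartan_field \<theta> \<xi> (\<gamma> t)))"
    by (rule has_velocity_compose[OF AP AB \<pi> open_UNIV UNIV_I cont vel])
  then have "has_velocity vec_atlas (\<lambda>t. \<Psi> (\<pi> (\<gamma> t))) t {0..\<delta>}
      (tangent_map AB vec_atlas \<Psi> (\<pi> (\<gamma> t)) (tangent_map AP AB \<pi> (\<gamma> t) (cartan_field \<theta> \<xi> (\<gamma> t))))"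
    by (rule has_velocity_compose[OF AB topological_atlas_vec_atlas \<Psi>' open_UNIV UNIV_I
          continuous_C1_map_compose[where \<gamma> = \<gamma>, OF \<pi> open_UNIV UNIV_I cont]])
  then show "((\<lambda>t. \<Psi> (\<pi> (\<gamma> t))) has_real_derivative \<kappa>a (J (chi (\<gamma> t))) \<xi>) (at t within {0..\<delta>})"
    by (simp add: has_velocity_real kempf_ness_derivative[OF \<Psi>] cartan_field_theta(1)[OF geom])
  have "has_velocity AM (\<lambda>t. chi (\<gamma> t)) t {0..\<delta>}
      (tangent_map AP AM chi (\<gamma> t) (cartan_field \<theta> \<xi> (\<gamma> t)))"
    by (rule has_velocity_compose[OF AP AM chi open_UNIV UNIV_I cont vel])
  then have velJ: "has_velocity vec_atlas (\<lambda>t. J (chi (\<gamma> t))) t {0..\<delta>}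
      (calabi AP AM \<theta> chi J (\<gamma> t) \<xi>)"
    unfolding calabi_def inf_action_def
    by (rule has_velocity_compose[OF AM topological_atlas_vec_atlas smooth_map_on_imp_C1_map_on[OF J]
          open_UNIV UNIV_I continuous_C1_map_compose[where \<gamma> = \<gamma>, OF chi open_UNIV UNIV_I cont]])
  have "continuous_on UNIV (\<lambda>(x, y). \<kappa>a x y)"
    using \<kappa>a by (simp add: continuous_bilinear_def)
  moreover have "continuous_on UNIV (\<lambda>\<mu>. (\<mu>, \<xi>))"
    by (intro continuous_on_Pair continuous_on_id continuous_on_const)
  ultimately have "continuous_on UNIV (\<lambda>\<mu>. (\<lambda>(x, y). \<kappa>a x y) (\<mu>, \<xi>))"
    by (rule continuous_on_compose2) simp
  then have "continuous_linear (\<lambda>\<mu>. \<kappa>a \<mu> \<xi>)"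
    using \<kappa>a by (simp add: continuous_linear_def continuous_bilinear_def)
  from has_velocity_continuous_linear[where L = "\<lambda>\<mu>. \<kappa>a \<mu> \<xi>", OF this velJ]
  show "((\<lambda>t. \<kappa>a (J (chi (\<gamma> t))) \<xi>) has_real_derivative
      \<kappa>a (calabi AP AM \<theta> chi J (\<gamma> t) \<xi>) \<xi>) (at t within {0..\<delta>})"
    by (simp add: has_velocity_real)
qed

text \<open>
  At the end points of the interval the derivatives are one-sided. The mean value theorem applied to
  \<open>f\<close> on both sides of an intermediate point, and then to \<open>f'\<close>, compares the slopes.
\<close>

lemma convex_on_second_derivative_nonneg:
  fixes f f' f'' :: "real \<Rightarrow> real"
  assumes f: "\<And>t. t \<in> {a..b} \<Longrightarrow> (f has_real_derivative f' t) (at t within {a..b})"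
    and f': "\<And>t. t \<in> {a..b} \<Longrightarrow> (f' has_real_derivative f'' t) (at t within {a..b})"
    and nonneg: "\<And>t. t \<in> {a..b} \<Longrightarrow> f'' t \<ge> 0"
  shows "convex_on {a..b} f"
proof (rule convex_on_linorderI)
  have mvt: "\<exists>c\<in>{x<..<y}. g y - g x = g' c * (y - x)"
    if "\<And>t. t \<in> {a..b} \<Longrightarrow> (g has_real_derivative g' t) (at t within {a..b})"
      and "a \<le> x" "x < y" "y \<le> b" for g g' :: "real \<Rightarrow> real" and x y
  proof (rule mvt_simple[OF \<open>x < y\<close>, of g "\<lambda>t h. g' t * h"])
    fix t assume "x \<le> t" "t \<le> y"
    then have "(g has_real_derivative g' t) (at t within {x..y})"
      using that by (intro has_field_derivative_subset[OF that(1)]) auto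
    then show "(g has_derivative (\<lambda>h. g' t * h)) (at t within {x..y})"
      by (simp add: has_field_derivative_def)
  qed
  fix r x y :: real
  assume r: "0 < r" "r < 1" and xy: "x \<in> {a..b}" "y \<in> {a..b}" "x < y"
  define z where "z = (1 - r) * x + r * y"
  have zx: "z - x = r * (y - x)" and yz: "y - z = (1 - r) * (y - x)"
    by (simp_all add: z_def algebra_simps)
  have "z - x > 0" "y - z > 0"
    unfolding zx yz using r xy by simp_all
  then have z: "x < z" "z < y"
    by simp_all
  obtain c where c: "c \<in> {x<..<z}" "f z - f x = f' c * (z - x)"
    using mvt[OF f, of x z] xy z by auto
  obtain d where d: "d \<in> {z<..<y}" "f y - f z = f' d * (y - z)"
    using mvt[OF f, of z y] xy z by auto
  obtain u where u: "u \<in> {c<..<d}" "f' d - f' c = f'' u * (d - c)"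
    using mvt[OF f', of c d] xy c d by auto
  have "f'' u * (d - c) \<ge> 0"
    using nonneg[of u] u xy c d by (intro mult_nonneg_nonneg) auto
  then have "(f' d - f' c) * (r * (1 - r) * (y - x)) \<ge> 0"
    using u(2) r xy by (intro mult_nonneg_nonneg) auto
  then have "(1 - r) * (f z - f x) \<le> r * (f y - f z)"
    unfolding c d zx yz by (simp add: algebra_simps)
  then have "f z \<le> (1 - r) * f x + r * f y"
    by (simp add: algebra_simps)
  then show "f ((1 - r) *\<^sub>R x + r *\<^sub>R y) \<le> (1 - r) * f x + r * f y"
    by (simp only: z_def real_scaleR_def)
qed simp


lemma kempf_ness_second_derivative:
  assumes geom: "cartan_geometry G AG AP AB \<iota> Ad actP \<pi> \<theta>"
    and AM: "manifold AM" and chi: "smooth_map AP AM chi" and J: "smooth_map AM vec_atlas J"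
    and \<kappa>a: "continuous_bilinear \<kappa>a"
    and \<Psi>: "kempf_ness_function AP AB \<pi> \<theta> chi \<kappa>a J \<Psi>"
    and \<gamma>: "integral_curve AP (cartan_field \<theta> \<xi>) \<delta> \<gamma>" and t: "t \<in> {0..\<delta>}"
  shows "has_second_deriv (\<lambda>t. \<Psi> (\<pi> (\<gamma> t))) (\<kappa>a (calabi AP AM \<theta> chi J (\<gamma> t) \<xi>) \<xi>) t {0..\<delta>}"
  unfolding has_second_deriv_def
  using kempf_ness_along_integral_curve[OF geom AM chi J \<kappa>a \<Psi> \<gamma>] t
  by (intro exI[of _ "\<lambda>t. \<kappa>a (J (chi (\<gamma> t))) \<xi>"]) simp

text \<open>
  On \<open>\<gg>\<close> the infinitesimal action is the one of \<open>G\<close> on \<open>M\<close>, since \<open>\<theta>\<inverse>(\<xi>)\<close> is then the fundamental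
  field on \<open>P\<close>. This connects the Calabi operator with the momentum map condition.
\<close>

lemma inf_action_subalgebra:
  assumes geom: "cartan_geometry G AG AP AB \<iota> Ad actP \<pi> \<theta>"
    and AM: "manifold AM" and actM: "smooth_action G AG AM actM"
    and chi: "smooth_map AP AM chi" and equiv: "\<And>g p. chi (actP g p) = actM g (chi p)"
  shows "inf_action AP AM \<theta> chi (\<iota> x) p = fundamental_field G AG AM actM x (chi p)"
proof -
  have P: "lie_group G AG" "manifold AP" "smooth_action G AG AP actP"
    using geom by (simp_all add: cartan_geometry_def principal_bundle_def)
  have "\<theta> p (fundamental_field G AG AP actP x p) = \<iota> x"
    using geom by (simp add: cartan_geometry_def)
  then have "cartan_field \<theta> (\<iota> x) p = fundamental_field G AG AP actP x p"
    using cartan_field_theta(2)[OF geom] by metis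
  moreover have "tangent_map AP AM chi p (fundamental_field G AG AP actP x p) =
      fundamental_field G AG AM actM x (chi p)"
    by (rule tangent_map_fundamental_field[OF P AM actM chi]) (rule equiv)
  ultimately show ?thesis
    by (simp add: inf_action_def)
qed

lemma inf_action_zero:
  assumes geom: "cartan_geometry G AG AP AB \<iota> Ad actP \<pi> \<theta>"
  shows "inf_action AP AM \<theta> chi 0 p = 0"
proof -
  have "\<theta> p 0 = 0"
    using geom linear_0[of "\<theta> p"] by (simp add: cartan_geometry_def smooth_1form_def)
  then have "cartan_field \<theta> 0 p = 0"
    using cartan_field_theta(2)[OF geom] by metis
  then show ?thesis
    by (simp add: inf_action_def tangent_map_def)
qed

lemma symplectic_form_antisym:
  assumes "symplectic_form A \<omega>"
  shows "\<omega> p X Y = - \<omega> p Y X"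
proof -
  have lin: "linear (\<omega> p X)" "linear (\<omega> p Y)" "linear (\<lambda>X. \<omega> p X (X' + Y'))"
    and alt: "\<omega> p Z Z = 0" for X' Y' Z
    using assms by (auto simp: symplectic_form_def smooth_bilinear_form_def)
  have "\<omega> p (X + Y) (X + Y) = \<omega> p X X + \<omega> p X Y + (\<omega> p Y X + \<omega> p Y Y)"
    using linear_add[OF lin(3)] linear_add[OF lin(1)] linear_add[OF lin(2)] by simp
  then show ?thesis
    by (simp add: alt)
qed

lemma riemannian_norm_power2:
  assumes "riemannian_metric A h"
  shows "(riemannian_norm h p X)\<^sup>2 = h p X X"
proof -
  have "h p X X \<ge> 0"
  proof (cases "X = 0")
    case True
    then show ?thesis
      using assms linear_0[of "h p 0"] by (simp add: riemannian_metric_def smooth_bilinear_form_def)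
  next
    case False
    then show ?thesis
      using assms by (simp add: riemannian_metric_def less_imp_le)
  qed
  then show ?thesis
    by (simp add: riemannian_norm_def)
qed

theorem proposition2p15:
  fixes G :: "('g::t2_space) monoid"
    and AG :: "('g, 'l::locally_convex) chart set"
    and AM :: "('m::t2_space, 'e::locally_convex) chart set"
    and AP :: "('p::t2_space, 'f::locally_convex) chart set"
    and AB :: "('b::t2_space, 'h::locally_convex) chart set"
    and abr :: "'a::locally_convex \<Rightarrow> 'a \<Rightarrow> 'a" and \<iota> :: "'l \<Rightarrow> 'a" and Ad :: "'g \<Rightarrow> 'a \<Rightarrow> 'a"
    and \<omega> :: "'m \<Rightarrow> 'e \<Rightarrow> 'e \<Rightarrow> real" and actM :: "'g \<Rightarrow> 'm \<Rightarrow> 'm"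
    and \<kappa> :: "'d::locally_convex \<Rightarrow> 'l \<Rightarrow> real" and coAd :: "'g \<Rightarrow> 'd \<Rightarrow> 'd"
    and J :: "'m \<Rightarrow> 'd" and \<sigma> :: "'g \<Rightarrow> 'd"
    and actP :: "'g \<Rightarrow> 'p \<Rightarrow> 'p" and \<pi> :: "'p \<Rightarrow> 'b" and \<theta> :: "'p \<Rightarrow> 'f \<Rightarrow> 'a"
    and chi :: "'p \<Rightarrow> 'm" and m :: 'm and \<kappa>a :: "'d \<Rightarrow> 'a \<Rightarrow> real" and \<Psi> :: "'b \<Rightarrow> real"
  assumes "manifold AM" and "symplectic_form AM \<omega>"
    and "lie_group G AG" and "symplectic_action G AG AM \<omega> actM"
    and "nondegenerate_pairing \<kappa>" and "coadjoint_map G AG \<kappa> coAd"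
    and "momentum_map G AG AM \<omega> actM \<kappa> J" and "nonequivariance_cocycle G actM coAd J \<sigma>"
    and "klein_pair G AG abr \<iota> Ad"
    and "cartan_geometry G AG AP AB \<iota> Ad actP \<pi> \<theta>" and "simply_connected (UNIV :: 'b set)"
    and "orbit_through AP AM abr actP actM chi m"
    and "duality G \<iota> Ad coAd \<kappa>a"
    and "a_equivariant AP AM abr \<theta> chi \<kappa>a J \<sigma>" and "torsion_free AP abr \<iota> \<theta>"
    and "kempf_ness_function AP AB \<pi> \<theta> chi \<kappa>a J \<Psi>"
  shows
    "(\<forall>b. (critical_point AB \<Psi> b \<longleftrightarrow> (\<exists>p\<in>\<pi> -` {b}. \<forall>\<xi>. \<kappa>a (J (chi p)) \<xi> = 0)) \<and>
          (critical_point AB \<Psi> b \<longleftrightarrow> (\<forall>p\<in>\<pi> -` {b}. \<forall>\<xi>. \<kappa>a (J (chi p)) \<xi> = 0)))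
   \<and> (\<forall>\<xi> \<delta> \<gamma>. integral_curve AP (cartan_field \<theta> \<xi>) \<delta> \<gamma> \<and> critical_point AB \<Psi> (\<pi> (\<gamma> 0)) \<longrightarrow>
        has_second_deriv (\<lambda>t. \<Psi> (\<pi> (\<gamma> t))) (\<kappa>a (calabi AP AM \<theta> chi J (\<gamma> 0) \<xi>) \<xi>) 0 {0..\<delta>})
   \<and> (\<forall>j \<mm> e.
        almost_complex AM j \<and> riemannian_metric AM (compatible_metric \<omega> j) \<and>
        complexified_klein_pair G AG abr \<iota> Ad \<mm> e \<and>
        (\<forall>\<mu> x. \<forall>y\<in>\<mm>. \<kappa>a \<mu> (cplx e x y) = - \<kappa> \<mu> y) \<and>
        (\<forall>p x. \<forall>y\<in>\<mm>. inf_action AP AM \<theta> chi (cplx e x y) p =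
           inf_action AP AM \<theta> chi (\<iota> x) p + j (chi p) (inf_action AP AM \<theta> chi (\<iota> y) p))
        \<longrightarrow>
        (\<forall>\<xi> \<delta> \<gamma>. integral_curve AP (cartan_field \<theta> \<xi>) \<delta> \<gamma> \<and> critical_point AB \<Psi> (\<pi> (\<gamma> 0)) \<longrightarrow>
           has_second_deriv (\<lambda>t. \<Psi> (\<pi> (\<gamma> t)))
             (- \<kappa> (calabi AP AM \<theta> chi J (\<gamma> 0) (cplx e 0 (im_part e \<xi>))) (im_part e \<xi>)) 0 {0..\<delta>} \<and>
           - \<kappa> (calabi AP AM \<theta> chi J (\<gamma> 0) (cplx e 0 (im_part e \<xi>))) (im_part e \<xi>)
             = (riemannian_norm (compatible_metric \<omega> j) (chi (\<gamma> 0))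
                  (inf_action AP AM \<theta> chi (\<iota> (im_part e \<xi>)) (\<gamma> 0)))\<^sup>2) \<and>
        (\<forall>\<xi>\<in>cplx e 0 ` \<mm>. \<forall>\<delta> \<gamma>. integral_curve AP (cartan_field \<theta> \<xi>) \<delta> \<gamma> \<longrightarrow>
           convex_on {0..\<delta>} (\<lambda>t. \<Psi> (\<pi> (\<gamma> t))) \<and>
           (\<forall>t\<in>{0..\<delta>}. has_second_deriv (\<lambda>t. \<Psi> (\<pi> (\<gamma> t)))
              ((riemannian_norm (compatible_metric \<omega> j) (chi (\<gamma> t))
                  (inf_action AP AM \<theta> chi \<xi> (\<gamma> t)))\<^sup>2) t {0..\<delta>})))"
proof -
  note AM = \<open>manifold AM\<close> and geom = \<open>cartan_geometry G AG AP AB \<iota> Ad actP \<pi> \<theta>\<close>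
    and \<Psi> = \<open>kempf_ness_function AP AB \<pi> \<theta> chi \<kappa>a J \<Psi>\<close>
  have actM: "smooth_action G AG AM actM"
    using \<open>symplectic_action G AG AM \<omega> actM\<close> by (simp add: symplectic_action_def)
  have chi: "smooth_map AP AM chi" and equiv: "\<And>g p. chi (actP g p) = actM g (chi p)"
    using \<open>orbit_through AP AM abr actP actM chi m\<close> by (auto simp: orbit_through_def)
  have J: "smooth_map AM vec_atlas J"
    using \<open>momentum_map G AG AM \<omega> actM \<kappa> J\<close> by (simp add: momentum_map_def)
  have \<kappa>a: "continuous_bilinear \<kappa>a" and \<kappa>a_\<iota>: "\<And>\<mu> x. \<kappa>a \<mu> (\<iota> x) = 0"
    using \<open>duality G \<iota> Ad coAd \<kappa>a\<close> by (auto simp: duality_def)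
  have pb: "principal_bundle G AG AP AB actP \<pi>"
    using geom by (simp add: cartan_geometry_def)
  note second = kempf_ness_second_derivative[OF geom AM chi J \<kappa>a \<Psi>]
  let ?C = "calabi AP AM \<theta> chi J" and ?\<rho> = "inf_action AP AM \<theta> chi"

  have part_i: "(critical_point AB \<Psi> b \<longleftrightarrow> (\<exists>p\<in>\<pi> -` {b}. \<forall>\<xi>. \<kappa>a (J (chi p)) \<xi> = 0)) \<and>
      (critical_point AB \<Psi> b \<longleftrightarrow> (\<forall>p\<in>\<pi> -` {b}. \<forall>\<xi>. \<kappa>a (J (chi p)) \<xi> = 0))" for b
  proof -
    have "critical_point AB \<Psi> b \<longleftrightarrow> (\<forall>\<xi>. \<kappa>a (J (chi p)) \<xi> = 0)" if "p \<in> \<pi> -` {b}" for p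
      using kempf_ness_critical_point_iff[OF geom \<Psi>, of p] that by simp
    moreover obtain p where "\<pi> p = b"
      using principal_bundle_projection_surj[OF pb] .
    ultimately show ?thesis
      by blast
  qed

  have part_ii: "has_second_deriv (\<lambda>t. \<Psi> (\<pi> (\<gamma> t))) (\<kappa>a (?C (\<gamma> 0) \<xi>) \<xi>) 0 {0..\<delta>}"
    if "integral_curve AP (cartan_field \<theta> \<xi>) \<delta> \<gamma>" for \<xi> \<delta> \<gamma>
    using second[OF that, of 0] that by (simp add: integral_curve_def)

  have part_iii:
    "(\<forall>\<xi> \<delta> \<gamma>. integral_curve AP (cartan_field \<theta> \<xi>) \<delta> \<gamma> \<and> critical_point AB \<Psi> (\<pi> (\<gamma> 0)) \<longrightarrow>
        has_second_deriv (\<lambda>t. \<Psi> (\<pi> (\<gamma> t)))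
          (- \<kappa> (?C (\<gamma> 0) (cplx e 0 (im_part e \<xi>))) (im_part e \<xi>)) 0 {0..\<delta>} \<and>
        - \<kappa> (?C (\<gamma> 0) (cplx e 0 (im_part e \<xi>))) (im_part e \<xi>)
          = (riemannian_norm (compatible_metric \<omega> j) (chi (\<gamma> 0)) (?\<rho> (\<iota> (im_part e \<xi>)) (\<gamma> 0)))\<^sup>2) \<and>
     (\<forall>\<xi>\<in>cplx e 0 ` \<mm>. \<forall>\<delta> \<gamma>. integral_curve AP (cartan_field \<theta> \<xi>) \<delta> \<gamma> \<longrightarrow>
        convex_on {0..\<delta>} (\<lambda>t. \<Psi> (\<pi> (\<gamma> t))) \<and>
        (\<forall>t\<in>{0..\<delta>}. has_second_deriv (\<lambda>t. \<Psi> (\<pi> (\<gamma> t)))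
           ((riemannian_norm (compatible_metric \<omega> j) (chi (\<gamma> t)) (?\<rho> \<xi> (\<gamma> t)))\<^sup>2) t {0..\<delta>}))"
    if j: "almost_complex AM j" and metric: "riemannian_metric AM (compatible_metric \<omega> j)"
      and e: "complexified_klein_pair G AG abr \<iota> Ad \<mm> e"
      and \<kappa>a_cplx: "\<And>\<mu> x y. y \<in> \<mm> \<Longrightarrow> \<kappa>a \<mu> (cplx e x y) = - \<kappa> \<mu> y"
      and \<rho>_cplx: "\<And>p x y. y \<in> \<mm> \<Longrightarrow> ?\<rho> (cplx e x y) p = ?\<rho> (\<iota> x) p + j (chi p) (?\<rho> (\<iota> y) p)"
    for j \<mm> e
  proof -
    have momentum: "\<kappa> (?C p \<xi>) y = - \<omega> (chi p) (?\<rho> (\<iota> y) p) (?\<rho> \<xi> p)" for p \<xi> y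
    proof -
      have "\<omega> (chi p) (fundamental_field G AG AM actM y (chi p)) (?\<rho> \<xi> p) + \<kappa> (?C p \<xi>) y = 0"
        using \<open>momentum_map G AG AM \<omega> actM \<kappa> J\<close> by (simp add: momentum_map_def calabi_def)
      moreover have "?\<rho> (\<iota> y) p = fundamental_field G AG AM actM y (chi p)"
        by (rule inf_action_subalgebra[OF geom AM actM chi]) (rule equiv)
      ultimately show ?thesis
        by simp
    qed
    have norm: "(riemannian_norm (compatible_metric \<omega> j) q X)\<^sup>2 = \<omega> q X (j q X)" for q X
      using riemannian_norm_power2[OF metric] by (simp add: compatible_metric_def)
    have "linear \<iota>"
      using \<open>klein_pair G AG abr \<iota> Ad\<close> by (simp add: klein_pair_def)
    then have \<rho>_i: "?\<rho> (cplx e 0 y) p = j (chi p) (?\<rho> (\<iota> y) p)" if "y \<in> \<mm>" for y p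
      using \<rho>_cplx[OF that] by (simp add: linear_0 inf_action_zero[OF geom])
    have i_norm: "- \<kappa> (?C p (cplx e 0 y)) y =
        (riemannian_norm (compatible_metric \<omega> j) (chi p) (?\<rho> (\<iota> y) p))\<^sup>2" if "y \<in> \<mm>" for p y
      by (simp add: momentum norm \<rho>_i[OF that])
    have homeo: "homeomorphism UNIV (UNIV \<times> \<mm>) e (inv_into UNIV e)"
      using e by (simp add: complexified_klein_pair_def)
    have im: "im_part e \<xi> \<in> \<mm>" "cplx e (fst (e \<xi>)) (im_part e \<xi>) = \<xi>" for \<xi>
    proof -
      have "e \<xi> \<in> UNIV \<times> \<mm>"
        using homeomorphism_image1[OF homeo] by blast
      then show "im_part e \<xi> \<in> \<mm>"
        by (auto simp: im_part_def)
      show "cplx e (fst (e \<xi>)) (im_part e \<xi>) = \<xi>"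
        using homeomorphism_apply1[OF homeo] by (simp add: cplx_def im_part_def)
    qed
    have critical: "\<kappa>a (?C p \<xi>) \<xi> = - \<kappa> (?C p (cplx e 0 (im_part e \<xi>))) (im_part e \<xi>)"
      if crit: "critical_point AB \<Psi> (\<pi> p)" for p \<xi>
    proof -
      define x y where "x = fst (e \<xi>)" and "y = im_part e \<xi>"
      have y: "y \<in> \<mm>" and \<xi>: "\<xi> = cplx e x y"
        using im by (simp_all add: x_def y_def)
      have lin: "linear (\<omega> (chi p) X)" for X
        using \<open>symplectic_form AM \<omega>\<close> by (simp add: symplectic_form_def smooth_bilinear_form_def)
      have \<kappa>a_\<xi>: "\<kappa>a \<mu> \<xi> = - \<kappa> \<mu> y" for \<mu>
        using \<kappa>a_cplx[OF y] by (simp add: \<xi>)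
      \<comment> \<open>Equivariance, with \<open>x\<close> and \<open>\<xi>\<close>, removes the contribution of the real part \<open>x\<close>.\<close>
      have "\<kappa>a (?C p (\<iota> x)) \<xi> - \<kappa>a (?C p \<xi>) (\<iota> x) = - \<kappa>a (J (chi p)) (abr (\<iota> x) \<xi>)"
        using \<open>a_equivariant AP AM abr \<theta> chi \<kappa>a J \<sigma>\<close> by (simp add: a_equivariant_def)
      then have "\<kappa> (?C p (\<iota> x)) y = 0"
        using kempf_ness_critical_point_iff[OF geom \<Psi>] crit by (simp add: \<kappa>a_\<iota> \<kappa>a_\<xi>)
      then have "\<omega> (chi p) (?\<rho> (\<iota> y) p) (?\<rho> (\<iota> x) p) = 0"
        by (simp add: momentum)
      moreover have "?\<rho> \<xi> p = ?\<rho> (\<iota> x) p + ?\<rho> (cplx e 0 y) p"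
        using \<rho>_cplx[OF y] \<rho>_i[OF y] by (simp add: \<xi>)
      ultimately have "\<kappa> (?C p \<xi>) y = \<kappa> (?C p (cplx e 0 y)) y"
        by (simp add: momentum linear_add[OF lin])
      then show ?thesis
        by (simp add: \<kappa>a_\<xi> flip: y_def)
    qed
    have along_i: "\<kappa>a (?C p (cplx e 0 y)) (cplx e 0 y) =
        (riemannian_norm (compatible_metric \<omega> j) (chi p) (?\<rho> (cplx e 0 y) p))\<^sup>2" if "y \<in> \<mm>" for p y
    proof -
      define v where "v = ?\<rho> (\<iota> y) p"
      have jj: "j (chi p) (j (chi p) v) = - v"
        using j by (simp add: almost_complex_def)
      have "linear (\<omega> (chi p) (j (chi p) v))"
        using \<open>symplectic_form AM \<omega>\<close> by (simp add: symplectic_form_def smooth_bilinear_form_def)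
      then have "\<omega> (chi p) (j (chi p) v) (j (chi p) (j (chi p) v)) = \<omega> (chi p) v (j (chi p) v)"
        using symplectic_form_antisym[OF \<open>symplectic_form AM \<omega>\<close>, of "chi p" "j (chi p) v" v]
        by (simp add: jj linear_neg)
      then show ?thesis
        by (simp add: \<kappa>a_cplx[OF that] momentum norm \<rho>_i[OF that] flip: v_def)
    qed
    show ?thesis
    proof (intro conjI allI impI ballI)
      fix \<xi> \<delta> \<gamma>
      assume "integral_curve AP (cartan_field \<theta> \<xi>) \<delta> \<gamma> \<and> critical_point AB \<Psi> (\<pi> (\<gamma> 0))"
      then show "has_second_deriv (\<lambda>t. \<Psi> (\<pi> (\<gamma> t)))
          (- \<kappa> (?C (\<gamma> 0) (cplx e 0 (im_part e \<xi>))) (im_part e \<xi>)) 0 {0..\<delta>}"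
        using part_ii by (simp flip: critical)
      show "- \<kappa> (?C (\<gamma> 0) (cplx e 0 (im_part e \<xi>))) (im_part e \<xi>)
          = (riemannian_norm (compatible_metric \<omega> j) (chi (\<gamma> 0)) (?\<rho> (\<iota> (im_part e \<xi>)) (\<gamma> 0)))\<^sup>2"
        using i_norm im(1) by blast
    next
      fix \<xi> \<delta> \<gamma>
      assume "\<xi> \<in> cplx e 0 ` \<mm>" and \<gamma>: "integral_curve AP (cartan_field \<theta> \<xi>) \<delta> \<gamma>"
      then have eq: "\<kappa>a (?C p \<xi>) \<xi> = (riemannian_norm (compatible_metric \<omega> j) (chi p) (?\<rho> \<xi> p))\<^sup>2" for p
        using along_i by blast
      show "convex_on {0..\<delta>} (\<lambda>t. \<Psi> (\<pi> (\<gamma> t)))"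
        using kempf_ness_along_integral_curve[OF geom AM chi J \<kappa>a \<Psi> \<gamma>]
        by (rule convex_on_second_derivative_nonneg) (simp_all add: eq)
      show "has_second_deriv (\<lambda>t. \<Psi> (\<pi> (\<gamma> t)))
          ((riemannian_norm (compatible_metric \<omega> j) (chi (\<gamma> t)) (?\<rho> \<xi> (\<gamma> t)))\<^sup>2) t {0..\<delta>}"
        if "t \<in> {0..\<delta>}" for t
        using second[OF \<gamma> that] by (simp add: eq)
    qed
  qed

  show ?thesis
  proof (intro conjI[OF allI conjI] allI impI, goal_cases)
    case (1 b)
    show ?case
      by (rule part_i)
  next
    case (2 \<xi> \<delta> \<gamma>)
    then show ?case
      by (elim conjE) (rule part_ii)
  next
    case (3 j \<mm> e)
    then show ?case
      by (elim conjE) (rule part_iii; simp)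
  qed
qed

end
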